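(* For every integer $D\geq 1$, there is a topological dynamical system $(K_D,\mathrm{id})$ (the identity homeomorphism on a nonempty compact metrizable space $K_D$) with $$\dim(K_D,\mathrm{id})=D$$ that does not embed equivariantly into the $2D$-cubical shift $(([0,1]^{2D})^{\mathbb Z},\sigma)$.
   Context: A topological dynamical system $(X,T)$ consists of a nonempty compact metrizable space $X$ and a homeomorphism $T\colon X\to X$. The $n$-cubical shift is $(([0,1]^n)^{\mathbb Z},\sigma)$ with the product topology and $(\sigma z)_k=z_{k+1}$. An equivariant embedding of $(X,T)$ into it is a topological embedding $F$ with $F\circ T=\sigma\circ F$. Dynamical dimension (Meyerovitch): let $\mathrm{Cov}(X)$ be the set of finite open covers of $X$, and $\mathrm{Prob}(X,T)$ the set of $T$-invariant Borel probability measures on $X$. For $\mathcal V\in\mathrm{Cov}(X)$ put $\mathrm{ord}(\mathcal V,x)=\#\{V\in\mathcal V:x\in V\}-1$ and $\mathrm{ord}(\mathcal V,T)=\sup_{\mu\in\mathrm{Prob}(X,T)}\int_X\mathrm{ord}(\mathcal V,x)\,d\mu(x)$. Write $\mathcal V\succeq\mathcal U$ if every $V\in\mathcal V$ is contained in some $U\in\mathcal U$. Then $$\dim(\mathcal U,T)=\inf_{\mathcal V\in\mathrm{Cov}(X),\ \mathcal V\succeq\mathcal U}\mathrm{ord}(\mathcal V,T),\qquad \dim(X,T)=\sup_{\mathcal U\in\mathrm{Cov}(X)}\dim(\mathcal U,T)\in[0,\infty].$$ *)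

theory Defs
  imports "HOL-Analysis.Analysis" "HOL-Probability.Probability"
begin

definition topological_dynamical_system :: "'a topology \<Rightarrow> ('a \<Rightarrow> 'a) \<Rightarrow> bool" where
  "topological_dynamical_system X T \<longleftrightarrow>
     topspace X \<noteq> {} \<and> compact_space X \<and> metrizable_space X \<and> homeomorphic_map X X T"

definition equivariant_embedding ::
    "'a topology \<Rightarrow> ('a \<Rightarrow> 'a) \<Rightarrow> 'b topology \<Rightarrow> ('b \<Rightarrow> 'b) \<Rightarrow> ('a \<Rightarrow> 'b) \<Rightarrow> bool" where
  "equivariant_embedding X T Y S F \<longleftrightarrow>
     embedding_map X Y F \<and> (\<forall>x\<in>topspace X. F (T x) = S (F x))"

(* Points of the cube are functions on the index set {..<n} that are undefined outside it,
   as in every product_topology. *)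
definition unit_cube_topology :: "nat \<Rightarrow> (nat \<Rightarrow> real) topology" where
  "unit_cube_topology n = product_topology (\<lambda>_. top_of_set {0..1}) {..<n}"

definition cubical_shift_topology :: "nat \<Rightarrow> (int \<Rightarrow> nat \<Rightarrow> real) topology" where
  "cubical_shift_topology n = product_topology (\<lambda>_. unit_cube_topology n) UNIV"

definition shift_map :: "(int \<Rightarrow> 'a) \<Rightarrow> int \<Rightarrow> 'a" where
  "shift_map z = (\<lambda>k. z (k + 1))"

definition borel_of :: "'a topology \<Rightarrow> 'a measure" where
  "borel_of X = sigma (topspace X) {U. openin X U}"

(* The type 'a is only the carrier of X; the points of the system are those of topspace X.
   For T a homeomorphism of X the measurability condition is automatic. *)
definition invariant_prob_measures :: "'a topology \<Rightarrow> ('a \<Rightarrow> 'a) \<Rightarrow> 'a measure set" where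
  "invariant_prob_measures X T =
     {M. prob_space M \<and> sets M = sets (borel_of X) \<and> T \<in> measurable M M \<and> distr M M T = M}"

definition finite_open_covers :: "'a topology \<Rightarrow> 'a set set set" where
  "finite_open_covers X = {\<V>. finite \<V> \<and> (\<forall>V\<in>\<V>. openin X V) \<and> \<Union>\<V> = topspace X}"

definition cover_refines :: "'a set set \<Rightarrow> 'a set set \<Rightarrow> bool" where
  "cover_refines \<V> \<U> \<longleftrightarrow> (\<forall>V\<in>\<V>. \<exists>U\<in>\<U>. V \<subseteq> U)"

definition ord_at :: "'a set set \<Rightarrow> 'a \<Rightarrow> real" where
  "ord_at \<V> x = real (card {V \<in> \<V>. x \<in> V}) - 1"

(* The truncation by ennreal never takes effect: ord_at is nonnegative at every point of
   the space covered. *)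
definition ord_cover :: "'a topology \<Rightarrow> ('a \<Rightarrow> 'a) \<Rightarrow> 'a set set \<Rightarrow> ennreal" where
  "ord_cover X T \<V> =
     (SUP M\<in>invariant_prob_measures X T. \<integral>\<^sup>+x. ennreal (ord_at \<V> x) \<partial>M)"

definition dynamical_dim_cover :: "'a topology \<Rightarrow> ('a \<Rightarrow> 'a) \<Rightarrow> 'a set set \<Rightarrow> ennreal" where
  "dynamical_dim_cover X T \<U> =
     (INF \<V>\<in>{\<V> \<in> finite_open_covers X. cover_refines \<V> \<U>}. ord_cover X T \<V>)"

definition dynamical_dim :: "'a topology \<Rightarrow> ('a \<Rightarrow> 'a) \<Rightarrow> ennreal" where
  "dynamical_dim X T = (SUP \<U>\<in>finite_open_covers X. dynamical_dim_cover X T \<U>)"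

end

theory Submission
  imports Defs "HOL-Homology.Homology"
begin

text \<open>For the identity, invariant measures are arbitrary, so the dynamical dimension is the covering
  dimension, and an equivariant embedding into the shift has constant sequences as values, so it amounts
  to an embedding into a cube of dimension \<open>2 D\<close>. Hence any compact space of dimension \<open>D\<close> that does not
  embed into Euclidean space of dimension \<open>2 D\<close> will do; by van Kampen and Flores the join of \<open>D + 1\<close>
  copies of three points is one. This rests on the Borsuk-Ulam theorem, obtained from the parity of the
  degree of odd maps of spheres. The parity is invariant under restriction to the equator for odd maps
  preserving it, and every odd map is homotopic to such a map through an odd perturbation whose image of
  the equator misses the poles.\<close>

section \<open>Odd maps of spheres\<close>

text \<open>An odd self-map of a sphere need not preserve the equator, and it can be pushed to do so
  only if the image of the equator misses the poles. Under a merely continuous map that image may be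
  the whole sphere. Odd Lipschitz approximations of the coordinates repair this: by counting cells,
  the Lipschitz image of an n-sphere cannot fill even a tiny cube of dimension n + 1. All spheres
  sit in one space of sequences with zero tails, so each is literally the equator of the next, and a
  map and its restriction can be compared in an induction on the dimension. The number three is what
  makes the van Kampen-Flores argument fit. For a single factor of three points the deleted join is
  a circle, and a join of D + 1 circles is a sphere of dimension 2D + 1. The 2D coordinates of a map
  together with the join parameter are exactly the 2D + 1 odd functions for which Borsuk-Ulam gives
  a common zero there.\<close>

definition unit_sphere :: "nat \<Rightarrow> (nat \<Rightarrow> real) set" where
  "unit_sphere n = {x. (\<Sum>i\<le>n. (x i)\<^sup>2) = 1 \<and> (\<forall>i>n. x i = 0)}"

lemma nsphere_eq_top_of_set: "nsphere n = top_of_set (unit_sphere n)"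
  by (simp add: nsphere unit_sphere_def euclidean_product_topology)

lemma topspace_nsphere: "topspace (nsphere n) = unit_sphere n"
  by (simp add: nsphere_eq_top_of_set)

lemma continuous_map_nsphere_iff:
  "continuous_map (nsphere n) (nsphere m) f \<longleftrightarrow>
     continuous_on (unit_sphere n) f \<and> f \<in> unit_sphere n \<rightarrow> unit_sphere m"
  by (auto simp: nsphere_eq_top_of_set continuous_map_in_subtopology)

lemma uminus_unit_sphere: "x \<in> unit_sphere n \<Longrightarrow> - x \<in> unit_sphere n"
  by (simp add: unit_sphere_def)

lemma unit_sphere_bounded:
  assumes "x \<in> unit_sphere n"
  shows "\<bar>x i\<bar> \<le> 1"
proof (cases "i \<le> n")
  case True
  have "(x i)\<^sup>2 \<le> (\<Sum>j\<le>n. (x j)\<^sup>2)"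
    using True by (intro member_le_sum) auto
  then show ?thesis
    using assms by (simp add: unit_sphere_def abs_square_le_1)
qed (use assms in \<open>auto simp: unit_sphere_def\<close>)

text \<open>Coordinates have modulus at most 1, so squares are bounded by moduli. This gives a bound
  free of square roots, weaker than the optimal \<open>1 / sqrt (n + 1)\<close>.\<close>

lemma ex_large_coordinate_unit_sphere:
  assumes "x \<in> unit_sphere n"
  obtains j where "j \<le> n" "1 / (real n + 1) \<le> \<bar>x j\<bar>"
proof (rule ccontr)
  assume "\<not> thesis"
  then have small: "\<bar>x j\<bar> < 1 / (real n + 1)" if "j \<le> n" for j
    using that \<open>\<And>j. \<lbrakk>j \<le> n; 1 / (real n + 1) \<le> \<bar>x j\<bar>\<rbrakk> \<Longrightarrow> thesis\<close> by fastforce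
  have "1 = (\<Sum>j\<le>n. (x j)\<^sup>2)"
    using assms by (simp add: unit_sphere_def)
  also have "\<dots> < (\<Sum>j\<le>n. 1 / (real n + 1))"
  proof (rule sum_strict_mono)
    fix j assume "j \<in> {..n}"
    have "(x j)\<^sup>2 = \<bar>x j\<bar> * \<bar>x j\<bar>"
      by (simp add: power2_eq_square)
    also have "\<dots> \<le> \<bar>x j\<bar> * 1"
      using unit_sphere_bounded[OF assms] by (intro mult_left_mono) auto
    also have "\<dots> < 1 / (real n + 1)"
      using small \<open>j \<in> {..n}\<close> by simp
    finally show "(x j)\<^sup>2 < 1 / (real n + 1)" .
  qed auto
  also have "\<dots> = 1"
    by simp
  finally show False by simp
qed

lemma unit_sphere_nonzero: "x \<in> unit_sphere n \<Longrightarrow> \<exists>i\<le>n. x i \<noteq> 0"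
  by (rule ccontr) (auto simp: unit_sphere_def)

text \<open>Tychonoff's theorem, transferred from the abstract product topology to the function
  type.\<close>

lemma compact_PiE_UNIV:
  fixes B :: "'i \<Rightarrow> 'b::topological_space set"
  assumes "\<And>i. compact (B i)"
  shows "compact {x. \<forall>i. x i \<in> B i}"
proof -
  have "compactin (product_topology (\<lambda>_. euclidean) UNIV) (PiE UNIV B)"
    using assms by (subst compactin_PiE) auto
  moreover have "PiE UNIV B = {x. \<forall>i. x i \<in> B i}"
    by (auto simp: PiE_def Pi_def extensional_def)
  ultimately show ?thesis
    by (simp add: euclidean_product_topology)
qed

lemma compact_unit_sphere: "compact (unit_sphere n)"
proof -
  have "unit_sphere n = {x. \<forall>i. x i \<in> {-1..1}} \<inter> 
      ({x. (\<Sum>i\<le>n. (x i)\<^sup>2) = 1} \<inter> (\<Inter>i\<in>{n<..}. {x. x i = 0}))"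
    using unit_sphere_bounded by (fastforce simp: unit_sphere_def abs_le_iff)
  moreover have "closed {x::nat\<Rightarrow>real. (\<Sum>i\<le>n. (x i)\<^sup>2) = 1}" "closed {x::nat\<Rightarrow>real. x i = 0}" for i
    by (intro closed_Collect_eq continuous_intros continuous_on_product_coordinates)+
  ultimately show ?thesis
    by (simp only:, intro compact_Int_closed compact_PiE_UNIV closed_Int closed_INT) auto
qed

section \<open>Radial projection and homotopies of sphere maps\<close>

definition normalize_upto :: "nat \<Rightarrow> (nat \<Rightarrow> real) \<Rightarrow> nat \<Rightarrow> real" where
  "normalize_upto n v = (\<lambda>i. if i \<le> n then v i / sqrt (\<Sum>j\<le>n. (v j)\<^sup>2) else 0)"

lemma sum_squares_pos:
  fixes v :: "nat \<Rightarrow> real"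
  assumes "\<exists>i\<le>n. v i \<noteq> 0"
  shows "0 < (\<Sum>j\<le>n. (v j)\<^sup>2)"
proof -
  obtain i where "i \<le> n" "v i \<noteq> 0"
    using assms by auto
  then show ?thesis
    by (intro sum_pos2[of _ i]) auto
qed

lemma normalize_upto_in_unit_sphere:
  assumes "\<exists>i\<le>n. v i \<noteq> 0"
  shows "normalize_upto n v \<in> unit_sphere n"
proof -
  have "(\<Sum>i\<le>n. (normalize_upto n v i)\<^sup>2) = (\<Sum>i\<le>n. (v i)\<^sup>2) / (\<Sum>i\<le>n. (v i)\<^sup>2)"
    using sum_squares_pos[OF assms]
    by (simp add: normalize_upto_def power_divide less_imp_le flip: sum_divide_distrib)
  then show ?thesis
    using sum_squares_pos[OF assms] by (simp add: unit_sphere_def normalize_upto_def)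
qed

lemma normalize_upto_unit_sphere: "v \<in> unit_sphere n \<Longrightarrow> normalize_upto n v = v"
  by (auto simp: normalize_upto_def unit_sphere_def)

lemma normalize_upto_uminus: "normalize_upto n (\<lambda>i. - v i) = - normalize_upto n v"
  by (auto simp: normalize_upto_def fun_eq_iff)

lemma continuous_on_normalize_upto:
  assumes "\<And>i. i \<le> n \<Longrightarrow> continuous_on S (\<lambda>x. g x i)"
    and "\<And>x. x \<in> S \<Longrightarrow> \<exists>i\<le>n. g x i \<noteq> 0"
  shows "continuous_on S (\<lambda>x. normalize_upto n (g x))"
proof (rule continuous_on_coordinatewise_then_product)
  fix i
  show "continuous_on S (\<lambda>x. normalize_upto n (g x) i)"
  proof (cases "i \<le> n")
    case True
    then show ?thesis
      unfolding normalize_upto_def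
      using assms sum_squares_pos[OF assms(2)]
      by (auto intro!: continuous_intros) force
  qed (simp add: normalize_upto_def)
qed

text \<open>The segment from \<open>h x\<close> to \<open>g x\<close> avoids the origin, since every
  point on it has positive inner product with \<open>h x\<close>; projecting it to the sphere is a
  homotopy. All homotopies needed later are obtained in this way.\<close>

lemma Brouwer_degree2_normalize_upto:
  assumes h: "continuous_on (unit_sphere n) h" "h \<in> unit_sphere n \<rightarrow> unit_sphere n"
    and g: "\<And>i. i \<le> n \<Longrightarrow> continuous_on (unit_sphere n) (\<lambda>x. g x i)"
    and pos: "\<And>x. x \<in> unit_sphere n \<Longrightarrow> 0 < (\<Sum>i\<le>n. g x i * h x i)"
  shows "Brouwer_degree2 n (\<lambda>x. normalize_upto n (g x)) = Brouwer_degree2 n h"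
proof -
  define H where "H = (\<lambda>(t::real, x) i. (1 - t) * h x i + t * g x i)"
  have nz: "\<exists>i\<le>n. H p i \<noteq> 0" if p: "p \<in> {0..1} \<times> unit_sphere n" for p
  proof (rule ccontr)
    assume *: "\<not> ?thesis"
    obtain t x where tx: "p = (t, x)" "0 \<le> t" "t \<le> 1" "x \<in> unit_sphere n"
      using p by auto
    have "0 = (\<Sum>i\<le>n. H p i * h x i)"
      using * by simp
    also have "\<dots> = (1 - t) * (\<Sum>i\<le>n. (h x i)\<^sup>2) + t * (\<Sum>i\<le>n. g x i * h x i)"
      by (simp add: H_def tx(1) sum_distrib_left algebra_simps power2_eq_square
          flip: sum.distrib sum_subtractf)
    also have "(\<Sum>i\<le>n. (h x i)\<^sup>2) = 1"
      using h(2) tx(4) by (auto simp: unit_sphere_def)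
    also have "(1 - t) * 1 + t * (\<Sum>i\<le>n. g x i * h x i) > 0"
      using pos[OF tx(4)] tx(2,3)
      by (cases "t = 0") (auto intro: add_nonneg_pos)
    finally show False by simp
  qed
  have cont: "continuous_on ({0..1} \<times> unit_sphere n) (\<lambda>p. normalize_upto n (H p))"
  proof (rule continuous_on_normalize_upto[OF _ nz])
    fix i assume "i \<le> n"
    have "continuous_on ({0..1} \<times> unit_sphere n) (\<lambda>p. k (snd p) i)"
      if "continuous_on (unit_sphere n) (\<lambda>x. k x i)" for k :: "(nat \<Rightarrow> real) \<Rightarrow> nat \<Rightarrow> real"
      by (rule continuous_on_compose2[OF that]) (auto intro: continuous_intros)
    from this[of g, OF g[OF \<open>i \<le> n\<close>]] this[of h, OF continuous_on_product_then_coordinatewise[OF h(1)]]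
    show "continuous_on ({0..1} \<times> unit_sphere n) (\<lambda>p. H p i)"
      by (simp add: H_def case_prod_unfold) (intro continuous_intros)
  qed
  have "homotopic_with (\<lambda>x. True) (nsphere n) (nsphere n) h (\<lambda>x. normalize_upto n (g x))"
    unfolding nsphere_eq_top_of_set
  proof (subst homotopic_with, simp, intro exI[of _ "\<lambda>p. normalize_upto n (H p)"] conjI ballI)
    show "continuous_map (prod_topology (top_of_set {0..1}) (top_of_set (unit_sphere n)))
        (top_of_set (unit_sphere n)) (\<lambda>p. normalize_upto n (H p))"
      using cont normalize_upto_in_unit_sphere[OF nz]
      by (auto simp: continuous_map_in_subtopology simp flip: subtopology_Times)
  next
    fix x assume "x \<in> topspace (top_of_set (unit_sphere n))"
    then have "h x \<in> unit_sphere n"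
      using h(2) by auto
    then show "normalize_upto n (H (0, x)) = h x"
      by (simp add: H_def normalize_upto_unit_sphere)
  qed (auto simp: H_def)
  then show ?thesis
    using Brouwer_degree2_homotopic by metis
qed

text \<open>Pigeonhole in place of measure zero: the image is covered by \<open>O(N^m)\<close> cells
  of size \<open>L / N\<close>, while a cube of dimension \<open>m + 1\<close> contains of the order
  of \<open>N^(m+1)\<close> grid points at distance at least \<open>2 * L / N\<close>. Two grid
  points cannot come from the same cell.\<close>

lemma exists_small_point_outside_image:
  fixes \<Phi> :: "'a \<Rightarrow> nat \<Rightarrow> real" and cls :: "nat \<Rightarrow> 'a \<Rightarrow> 'c"
  assumes "L > 0" "\<delta> > 0"
    and fin: "\<And>N. N \<ge> 1 \<Longrightarrow> finite (cls N ` A)"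
    and card: "\<And>N. N \<ge> 1 \<Longrightarrow> card (cls N ` A) \<le> C * N ^ m"
    and close: "\<And>N x x' i. N \<ge> 1 \<Longrightarrow> x \<in> A \<Longrightarrow> x' \<in> A \<Longrightarrow> cls N x = cls N x' \<Longrightarrow> i \<le> m \<Longrightarrow>
                  \<bar>\<Phi> x i - \<Phi> x' i\<bar> \<le> L / real N"
  obtains q where "\<And>i. 0 \<le> q i" "\<And>i. q i \<le> \<delta>" "\<not> (\<exists>x\<in>A. \<forall>i\<le>m. \<Phi> x i = q i)"
proof (rule ccontr)
  assume "\<not> thesis"
  then have hit: "\<exists>x\<in>A. \<forall>i\<le>m. \<Phi> x i = q i" if "\<And>i. 0 \<le> q i" "\<And>i. q i \<le> \<delta>" for q
    using that \<open>\<And>q. \<lbrakk>\<And>i. 0 \<le> q i; \<And>i. q i \<le> \<delta>; \<not> (\<exists>x\<in>A. \<forall>i\<le>m. \<Phi> x i = q i)\<rbrakk> \<Longrightarrow> thesis\<close>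
    by blast
  obtain k :: nat where k: "2 * L / \<delta> < real k"
    using reals_Archimedean2 by blast
  have "k \<ge> 1"
    using k assms(1,2) by (cases k) (auto simp: divide_less_0_iff)
  \<comment> \<open>\<open>p\<close> is the number of grid points per axis. With
    \<open>N = k * p\<close> the number of cells is at most \<open>(C * k ^ m) * p ^ m\<close>,
    below the \<open>p ^ (m + 1)\<close> grid points, while the grid has side at most
    \<open>2 * L / k\<close>, which \<open>k\<close> makes smaller than \<delta>.\<close>
  define p where "p = C * k ^ m + 1"
  then have p_pos: "p > 0"
    by simp
  define N where "N = k * p"
  have "N \<ge> 1"
    using \<open>k \<ge> 1\<close> by (simp add: N_def p_def)
  define G where "G = ({..m} \<rightarrow>\<^sub>E {..<p})"
  define q where "q = (\<lambda>w i. if i \<le> m then real (w i) * (2 * L / real N) else 0)" for w :: "nat \<Rightarrow> nat"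
  have step: "p * (2 * L / real N) \<le> \<delta>"
  proof -
    have "p * (2 * L / real N) = 2 * L / k"
      using \<open>k \<ge> 1\<close> p_pos by (simp add: N_def field_simps)
    also have "\<dots> \<le> \<delta>"
      using k assms(1,2) \<open>k \<ge> 1\<close> by (simp add: field_simps)
    finally show ?thesis .
  qed
  have "\<exists>x\<in>A. \<forall>i\<le>m. \<Phi> x i = q w i" if "w \<in> G" for w
  proof (rule hit)
    fix i
    show "0 \<le> q w i"
      using assms(1) by (simp add: q_def)
    show "q w i \<le> \<delta>"
    proof (cases "i \<le> m")
      case True
      then have "w i < p"
        using that by (auto simp: G_def)
      then have "real (w i) * (2 * L / real N) \<le> p * (2 * L / real N)"
        using assms(1) by (intro mult_right_mono) auto
      then show ?thesis
        using step True by (simp add: q_def)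
    qed (use assms in \<open>simp add: q_def\<close>)
  qed
  then obtain X where X: "\<And>w. w \<in> G \<Longrightarrow> X w \<in> A" "\<And>w i. w \<in> G \<Longrightarrow> i \<le> m \<Longrightarrow> \<Phi> (X w) i = q w i"
    by metis
  have "finite G"
    by (auto simp: G_def intro: finite_PiE)
  have "card ((\<lambda>w. cls N (X w)) ` G) \<le> card (cls N ` A)"
    using X(1) fin[OF \<open>N \<ge> 1\<close>] by (intro card_mono) auto
  also have "\<dots> \<le> C * N ^ m"
    by (rule card[OF \<open>N \<ge> 1\<close>])
  also have "\<dots> = (C * k ^ m) * p ^ m"
    by (simp add: N_def power_mult_distrib)
  also have "\<dots> < p * p ^ m"
    by (intro mult_strict_right_mono) (auto simp: p_def)
  also have "\<dots> = card G"
    by (simp add: G_def card_funcsetE)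
  finally have "\<not> inj_on (\<lambda>w. cls N (X w)) G"
    by (metis card_image less_irrefl)
  then obtain w w' where w: "w \<in> G" "w' \<in> G" "w \<noteq> w'" "cls N (X w) = cls N (X w')"
    by (auto simp: inj_on_def)
  obtain i where i: "i \<le> m" "w i \<noteq> w' i"
    using w(1-3) by (auto simp: G_def PiE_def extensional_def fun_eq_iff) metis
  have "1 \<le> \<bar>real (w i) - real (w' i)\<bar>"
    using i(2) by linarith
  then have "1 * (2 * L / real N) \<le> \<bar>real (w i) - real (w' i)\<bar> * (2 * L / real N)"
    using assms(1) by (intro mult_right_mono) auto
  also have "\<dots> = \<bar>q w i - q w' i\<bar>"
  proof -
    have "q w i - q w' i = (real (w i) - real (w' i)) * (2 * L / real N)"
      using i(1) by (simp add: q_def left_diff_distrib diff_divide_distrib)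
    then show ?thesis
      using assms(1) by (simp add: abs_mult)
  qed
  also have "\<dots> \<le> L / real N"
    using close[OF \<open>N \<ge> 1\<close> X(1)[OF w(1)] X(1)[OF w(2)] w(4) i(1)] X(2) w(1,2) i(1) by simp
  finally show False
    using assms(1) \<open>N \<ge> 1\<close> by (simp add: field_simps)
qed

text \<open>A point of the sphere is determined up to \<open>O(1/N)\<close> by the index and the sign of a coordinate of
  maximal modulus and by the integer parts of \<open>N\<close> times the other coordinates.\<close>

lemma unit_sphere_cells:
  obtains cls :: "nat \<Rightarrow> (nat \<Rightarrow> real) \<Rightarrow> nat \<times> bool \<times> (nat \<Rightarrow> int)" and C :: nat and K :: real
  where "K > 0"
    and "\<And>N. N \<ge> 1 \<Longrightarrow> finite (cls N ` unit_sphere m)"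
    and "\<And>N. N \<ge> 1 \<Longrightarrow> card (cls N ` unit_sphere m) \<le> C * N ^ m"
    and "\<And>N x y i. N \<ge> 1 \<Longrightarrow> x \<in> unit_sphere m \<Longrightarrow> y \<in> unit_sphere m \<Longrightarrow> cls N x = cls N y \<Longrightarrow>
           \<bar>x i - y i\<bar> \<le> K / real N"
proof -
  define top where "top x = (SOME j. j \<le> m \<and> (\<forall>i\<le>m. \<bar>x i\<bar> \<le> \<bar>x j\<bar>))" for x :: "nat \<Rightarrow> real"
  \<comment> \<open>Enumerates the indices other than \<open>j\<close>. Recording only these
    \<open>m\<close> coordinates gives the exponent \<open>m\<close> rather than
    \<open>m + 1\<close> in the number of cells.\<close>
  define skip where "skip j i = (if i < j then i else Suc i)" for j i :: nat
  define cls where "cls N x = (top x, 0 < x (top x),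
      restrict (\<lambda>i. \<lfloor>real N * x (skip (top x) i)\<rfloor>) {..<m})" for N x
  have "\<exists>j\<le>m. \<forall>i\<le>m. \<bar>x i\<bar> \<le> \<bar>x j\<bar>" for x :: "nat \<Rightarrow> real"
    using Max_in[of "(\<lambda>i. \<bar>x i\<bar>) ` {..m}"] Max_ge[of "(\<lambda>i. \<bar>x i\<bar>) ` {..m}"] by fastforce
  then have top: "top x \<le> m" "\<And>i. i \<le> m \<Longrightarrow> \<bar>x i\<bar> \<le> \<bar>x (top x)\<bar>" for x
    using someI_ex[of "\<lambda>j. j \<le> m \<and> (\<forall>i\<le>m. \<bar>x i\<bar> \<le> \<bar>x j\<bar>)"] unfolding top_def by auto
  have large: "1 / (m + 1) \<le> \<bar>x (top x)\<bar>" if x: "x \<in> unit_sphere m" for x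
  proof -
    obtain j where j: "j \<le> m" "1 / (real m + 1) \<le> \<bar>x j\<bar>"
      using ex_large_coordinate_unit_sphere[OF x] .
    have "1 / (real m + 1) \<le> \<bar>x (top x)\<bar>"
      using j(2) top(2)[OF j(1)] by (rule order_trans)
    then show ?thesis
      by (simp add: add.commute)
  qed
  have cls_in: "cls N ` unit_sphere m \<subseteq> {..m} \<times> UNIV \<times> ({..<m} \<rightarrow>\<^sub>E {- int N..int N})" for N
  proof -
    have "- int N \<le> \<lfloor>real N * t\<rfloor> \<and> \<lfloor>real N * t\<rfloor> \<le> int N" if "\<bar>t\<bar> \<le> 1" for t
    proof -
      have "\<bar>real N * t\<bar> \<le> real N * 1"
        unfolding abs_mult using that by (intro mult_mono) auto
      then show ?thesis
        by (auto simp: abs_le_iff le_floor_iff floor_le_iff)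
    qed
    then show ?thesis
      using top(1) unit_sphere_bounded by (auto simp: cls_def split: if_splits)
  qed
  have fin: "finite ({..m} \<times> (UNIV :: bool set) \<times> ({..<m} \<rightarrow>\<^sub>E {- int N..int N}))" for N
    by (intro finite_cartesian_product finite_PiE) auto
  show thesis
  proof (rule that[of "2 * (m + 1)^2" cls "2 * (m + 1) * 3 ^ m"])
    fix N :: nat assume "N \<ge> 1"
    show "finite (cls N ` unit_sphere m)"
      using finite_subset[OF cls_in fin] .
    have "card (cls N ` unit_sphere m) \<le> card ({..m} \<times> (UNIV :: bool set) \<times> ({..<m} \<rightarrow>\<^sub>E {- int N..int N}))"
      by (rule card_mono[OF fin cls_in])
    also have "\<dots> = (m + 1) * (2 * (2 * N + 1) ^ m)"
      by (simp add: card_cartesian_product card_funcsetE nat_add_distrib nat_mult_distrib)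
    also have "\<dots> \<le> (m + 1) * (2 * (3 * N) ^ m)"
      using \<open>N \<ge> 1\<close> by (intro mult_left_mono power_mono) auto
    finally show "card (cls N ` unit_sphere m) \<le> (2 * (m + 1) * 3 ^ m) * N ^ m"
      by (simp add: power_mult_distrib algebra_simps)
  next
    fix N :: nat and x y :: "nat \<Rightarrow> real" and i
    assume N: "N \<ge> 1" and x: "x \<in> unit_sphere m" and y: "y \<in> unit_sphere m" and eq: "cls N x = cls N y"
    define j where "j = top x"
    have j: "j \<le> m" "top y = j" "0 < x j \<longleftrightarrow> 0 < y j"
      using eq top(1)[of x] by (auto simp: cls_def j_def)
    have other: "\<bar>x i - y i\<bar> \<le> 1 / N" if "i \<noteq> j" "i \<le> m" for i
    proof -
      obtain k where k: "k < m" "skip j k = i"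
      proof (cases "i < j")
        case True
        then show ?thesis using j(1) by (intro that[of i]) (auto simp: skip_def)
      next
        case False
        then show ?thesis using that[of "i - 1"] \<open>i \<noteq> j\<close> \<open>i \<le> m\<close> by (auto simp: skip_def)
      qed
      have "\<lfloor>real N * x i\<rfloor> = \<lfloor>real N * y i\<rfloor>"
        using eq k j(2) by (auto simp: cls_def j_def restrict_def fun_eq_iff split: if_splits dest: spec[of _ k])
      then have "\<bar>real N * x i - real N * y i\<bar> \<le> 1"
        by linarith
      then have "real N * \<bar>x i - y i\<bar> \<le> 1"
        by (simp add: abs_mult flip: right_diff_distrib)
      then show ?thesis
        using N by (simp add: field_simps)
    qed
    \<comment> \<open>The equation of the sphere recovers the omitted coordinate. The squares at
      \<open>j\<close> differ only by what the other squares contribute, and since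
      \<open>x j\<close> and \<open>y j\<close> have the same sign and modulus at least
      \<open>1 / (m + 1)\<close>, the factor \<open>x j + y j\<close> can be divided out.\<close>
    have top_close: "\<bar>x j - y j\<bar> \<le> 2 * (m + 1)^2 / N"
    proof -
      have "1 / (m + 1) * \<bar>x j - y j\<bar> \<le> \<bar>x j + y j\<bar> * \<bar>x j - y j\<bar>"
        using large[OF x] large[OF y] j(2,3)
        by (intro mult_right_mono) (auto simp: j_def abs_if split: if_splits)
      also have "\<dots> = \<bar>(x j)\<^sup>2 - (y j)\<^sup>2\<bar>"
        by (simp add: power2_eq_square abs_mult[symmetric] algebra_simps)
      also have "\<dots> = \<bar>\<Sum>i\<in>{..m} - {j}. (y i)\<^sup>2 - (x i)\<^sup>2\<bar>"
      proof -
        have "(x j)\<^sup>2 + (\<Sum>i\<in>{..m} - {j}. (x i)\<^sup>2) = (y j)\<^sup>2 + (\<Sum>i\<in>{..m} - {j}. (y i)\<^sup>2)"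
          using x y sum.remove[of "{..m}" j "\<lambda>i. (x i)\<^sup>2"] sum.remove[of "{..m}" j "\<lambda>i. (y i)\<^sup>2"] j(1)
          by (simp add: unit_sphere_def)
        then show ?thesis
          by (simp add: sum_subtractf)
      qed
      also have "\<dots> \<le> (\<Sum>i\<in>{..m} - {j}. \<bar>(y i)\<^sup>2 - (x i)\<^sup>2\<bar>)"
        by (rule sum_abs)
      also have "\<dots> \<le> (\<Sum>i\<in>{..m} - {j}. 2 / N)"
      proof (rule sum_mono)
        fix i assume i: "i \<in> {..m} - {j}"
        have "\<bar>(y i)\<^sup>2 - (x i)\<^sup>2\<bar> = \<bar>y i + x i\<bar> * \<bar>x i - y i\<bar>"
          by (subst abs_minus_commute) (simp add: power2_eq_square abs_mult[symmetric] algebra_simps)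
        also have "\<dots> \<le> 2 * (1 / N)"
          using other[of i] i unit_sphere_bounded[OF x, of i] unit_sphere_bounded[OF y, of i]
          by (intro mult_mono) auto
        finally show "\<bar>(y i)\<^sup>2 - (x i)\<^sup>2\<bar> \<le> 2 / N" by simp
      qed
      also have "\<dots> = m * (2 / N)"
        using j(1) by simp
      also have "\<dots> \<le> (m + 1) * (2 / N)"
        by (intro mult_right_mono) auto
      finally show ?thesis
        using N by (simp add: field_simps power2_eq_square)
    qed
    have "1 / N \<le> 2 * (m + 1)^2 / N"
    proof (intro divide_right_mono)
      have "(1::real) \<le> (1 + real m)^2"
        by (intro one_le_power) simp
      then have "1 \<le> 2 * (1 + real m)^2"
        by linarith
      then show "1 \<le> real (2 * (m + 1)^2)"
        by simp
    qed simp
    moreover have "\<bar>x i - y i\<bar> = 0" if "i > m"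
      using x y that by (simp add: unit_sphere_def)
    ultimately show "\<bar>x i - y i\<bar> \<le> real (2 * (m + 1)^2) / N"
      using other[of i] top_close by (cases "i > m"; cases "i = j") force+
  qed auto
qed

text \<open>Lipschitz for the sup distance, which is not the metric of the function type; a common
  bound \<open>d\<close> on all coordinates replaces the supremum.\<close>

definition coord_lipschitz :: "(nat \<Rightarrow> real) set \<Rightarrow> real \<Rightarrow> ((nat \<Rightarrow> real) \<Rightarrow> real) \<Rightarrow> bool" where
  "coord_lipschitz S L f \<longleftrightarrow>
     (\<forall>x\<in>S. \<forall>y\<in>S. \<forall>d. (\<forall>j. \<bar>x j - y j\<bar> \<le> d) \<longrightarrow> \<bar>f x - f y\<bar> \<le> L * d)"

lemma coord_lipschitzD:
  "coord_lipschitz S L f \<Longrightarrow> x \<in> S \<Longrightarrow> y \<in> S \<Longrightarrow> (\<And>j. \<bar>x j - y j\<bar> \<le> d) \<Longrightarrow> \<bar>f x - f y\<bar> \<le> L * d"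
  by (simp add: coord_lipschitz_def)

lemma abs_mult_diff_le:
  fixes a b a' b' :: real
  assumes "\<bar>a\<bar> \<le> A" "\<bar>b'\<bar> \<le> B" "\<bar>a - a'\<bar> \<le> s" "\<bar>b - b'\<bar> \<le> t"
  shows "\<bar>a * b - a' * b'\<bar> \<le> B * s + A * t"
proof -
  have "\<bar>a * b - a' * b'\<bar> = \<bar>b' * (a - a') + a * (b - b')\<bar>"
    by (simp add: algebra_simps)
  also have "\<dots> \<le> \<bar>b'\<bar> * \<bar>a - a'\<bar> + \<bar>a\<bar> * \<bar>b - b'\<bar>"
    by (simp flip: abs_mult)
  also have "\<dots> \<le> B * s + A * t"
    using assms by (intro add_mono mult_mono) auto
  finally show ?thesis .
qed

text \<open>Lipschitz functions on a compact set are bounded, hence closed under products. They form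
  an algebra that contains the coordinates and so separates points, and Stone-Weierstrass
  applies.\<close>

lemma coord_lipschitz_approximation:
  assumes S: "compact S" and f: "continuous_on S f" and "\<epsilon> > 0"
  obtains g L where "continuous_on S g" "L \<ge> 0" "coord_lipschitz S L g"
    "\<And>x. x \<in> S \<Longrightarrow> \<bar>f x - g x\<bar> < \<epsilon>"
proof -
  let ?P = "\<lambda>g. continuous_on S g \<and> (\<exists>L\<ge>0. coord_lipschitz S L g)"
  have "\<exists>g. ?P g \<and> (\<forall>x\<in>S. \<bar>f x - g x\<bar> < \<epsilon>)"
  proof (rule Stone_Weierstrass_HOL[OF S])
    show "?P (\<lambda>x. c)" for c
      by (auto simp: coord_lipschitz_def intro: exI[of _ 0])
  next
    fix g h assume "?P g \<and> ?P h"
    then obtain L M where LM: "coord_lipschitz S L g" "coord_lipschitz S M h" "L \<ge> 0" "M \<ge> 0"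
      and cont: "continuous_on S g" "continuous_on S h"
      by auto
    have "coord_lipschitz S (L + M) (\<lambda>x. g x + h x)"
      unfolding coord_lipschitz_def
    proof (intro ballI allI impI)
      fix x y d assume "x \<in> S" "y \<in> S" "\<forall>j. \<bar>x j - y j\<bar> \<le> d"
      then have "\<bar>g x - g y\<bar> \<le> L * d" "\<bar>h x - h y\<bar> \<le> M * d"
        using LM(1,2) by (auto simp: coord_lipschitz_def)
      then show "\<bar>g x + h x - (g y + h y)\<bar> \<le> (L + M) * d"
        by (simp add: algebra_simps)
    qed
    then show "?P (\<lambda>x. g x + h x)"
      using LM(3,4) cont by (auto intro: continuous_intros exI[of _ "L + M"])
    obtain A where A: "\<And>x. x \<in> S \<Longrightarrow> \<bar>g x\<bar> \<le> A"
      using compact_imp_bounded[OF compact_continuous_image[OF cont(1) S]] by (auto simp: bounded_iff)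
    obtain B where B: "\<And>x. x \<in> S \<Longrightarrow> \<bar>h x\<bar> \<le> B"
      using compact_imp_bounded[OF compact_continuous_image[OF cont(2) S]] by (auto simp: bounded_iff)
    have "coord_lipschitz S (\<bar>B\<bar> * L + \<bar>A\<bar> * M) (\<lambda>x. g x * h x)"
      unfolding coord_lipschitz_def
    proof (intro ballI allI impI)
      fix x y d assume xy: "x \<in> S" "y \<in> S" "\<forall>j. \<bar>x j - y j\<bar> \<le> d"
      then have "\<bar>g x - g y\<bar> \<le> L * d" "\<bar>h x - h y\<bar> \<le> M * d"
        using LM(1,2) by (auto simp: coord_lipschitz_def)
      moreover have "\<bar>g x\<bar> \<le> \<bar>A\<bar>" "\<bar>h y\<bar> \<le> \<bar>B\<bar>"
        using A[OF xy(1)] B[OF xy(2)] by auto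
      ultimately have "\<bar>g x * h x - g y * h y\<bar> \<le> \<bar>B\<bar> * (L * d) + \<bar>A\<bar> * (M * d)"
        by (intro abs_mult_diff_le)
      then show "\<bar>g x * h x - g y * h y\<bar> \<le> (\<bar>B\<bar> * L + \<bar>A\<bar> * M) * d"
        by (simp add: algebra_simps)
    qed
    then show "?P (\<lambda>x. g x * h x)"
      using LM(3,4) cont by (auto intro!: continuous_intros exI[of _ "\<bar>B\<bar> * L + \<bar>A\<bar> * M"])
  next
    fix x y assume "x \<in> S \<and> y \<in> S \<and> x \<noteq> y"
    then obtain i where "x i \<noteq> y i"
      by auto
    moreover have "?P (\<lambda>x. x i)"
      by (auto simp: coord_lipschitz_def intro!: exI[of _ 1] continuous_on_subset[OF continuous_on_product_coordinates])
    ultimately show "\<exists>f. ?P f \<and> f x \<noteq> f y"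
      by (intro exI[of _ "\<lambda>x. x i"] conjI) auto
  qed (use f \<open>\<epsilon> > 0\<close> in auto)
  then show thesis
    using that by blast
qed

lemma continuous_on_uminus_fun [continuous_intros]:
  fixes f :: "'a::topological_space \<Rightarrow> 'i \<Rightarrow> real"
  assumes "continuous_on S f"
  shows "continuous_on S (\<lambda>x. - f x)"
  unfolding fun_Compl_def
  by (intro continuous_on_coordinatewise_then_product continuous_intros
      continuous_on_product_then_coordinatewise[OF assms])

lemma uminus_uminus_fun: "- (- f) = f" for f :: "'i \<Rightarrow> 'b::group_add"
  by (rule ext) simp

text \<open>Passing to the odd part of an approximation preserves the Lipschitz constant, and also
  the error because \<open>f\<close> is odd.\<close>

lemma odd_coord_lipschitz_approximation:
  assumes S: "compact S" "\<And>x. x \<in> S \<Longrightarrow> - x \<in> S"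
    and f: "continuous_on S f" "\<And>x. x \<in> S \<Longrightarrow> f (- x) = - f x" and "\<epsilon> > 0"
  obtains g L where "continuous_on S g" "L \<ge> 0" "coord_lipschitz S L g"
    "\<And>x. x \<in> S \<Longrightarrow> \<bar>f x - g x\<bar> < \<epsilon>" "\<And>x. x \<in> S \<Longrightarrow> g (- x) = - g x"
proof -
  obtain k L where k: "continuous_on S k" "L \<ge> 0" "coord_lipschitz S L k"
    "\<And>x. x \<in> S \<Longrightarrow> \<bar>f x - k x\<bar> < \<epsilon>"
    using coord_lipschitz_approximation[OF S(1) f(1) \<open>\<epsilon> > 0\<close>] by metis
  have half: "\<bar>(p - r) / 2 - (q - s) / 2\<bar> \<le> B" if "\<bar>p - q\<bar> \<le> B" "\<bar>r - s\<bar> \<le> B" for p q r s B :: real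
  proof -
    have "\<bar>(p - r) - (q - s)\<bar> \<le> 2 * B"
      using that by linarith
    then show ?thesis
      by (simp flip: diff_divide_distrib)
  qed
  show thesis
  proof (rule that[of "\<lambda>x. (k x - k (- x)) / 2" L])
    have "continuous_on S (\<lambda>x. k (- x))"
      using S(2) by (intro continuous_on_compose2[OF k(1)] continuous_intros) auto
    then show "continuous_on S (\<lambda>x. (k x - k (- x)) / 2)"
      using k(1) by (intro continuous_intros) auto
    show "coord_lipschitz S L (\<lambda>x. (k x - k (- x)) / 2)"
      unfolding coord_lipschitz_def
    proof (intro ballI allI impI)
      fix x y d assume xy: "x \<in> S" "y \<in> S" "\<forall>j. \<bar>x j - y j\<bar> \<le> d"
      have "\<bar>k x - k y\<bar> \<le> L * d"
        using xy by (intro coord_lipschitzD[OF k(3)]) auto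
      moreover have "\<bar>k (- x) - k (- y)\<bar> \<le> L * d"
        using xy S(2) by (intro coord_lipschitzD[OF k(3)]) (auto simp: abs_minus_commute)
      ultimately show "\<bar>(k x - k (- x)) / 2 - (k y - k (- y)) / 2\<bar> \<le> L * d"
        by (rule half)
    qed
    show "\<bar>f x - (k x - k (- x)) / 2\<bar> < \<epsilon>" if "x \<in> S" for x
    proof -
      have "\<bar>2 * f x - (k x - k (- x))\<bar> < 2 * \<epsilon>"
        using k(4)[OF that] k(4)[OF S(2)[OF that]] f(2)[OF that] by linarith
      then show ?thesis
        by (simp add: abs_less_iff field_simps)
    qed
    show "(k (- x) - k (- (- x))) / 2 = - ((k x - k (- x)) / 2)" for x
      by (simp only: uminus_uminus_fun minus_divide_left minus_diff_eq)
  qed (fact k(2))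
qed

lemma unit_sphere_subset_Suc: "unit_sphere n \<subseteq> unit_sphere (Suc n)"
  by (auto simp: unit_sphere_def)

text \<open>An odd perturbation of \<open>h\<close>, Lipschitz on the equator, can be sheared slightly so that the
  image of the equator avoids the last coordinate axis: the image is too thin to contain all
  directions near that axis.\<close>

lemma odd_perturbation_avoiding_axis:
  assumes h: "continuous_on (unit_sphere (Suc n)) h" "h \<in> unit_sphere (Suc n) \<rightarrow> unit_sphere (Suc n)"
    and odd: "\<And>x. x \<in> unit_sphere (Suc n) \<Longrightarrow> h (- x) = - h x"
  obtains g :: "(nat \<Rightarrow> real) \<Rightarrow> nat \<Rightarrow> real"
  where "\<And>i. continuous_on (unit_sphere (Suc n)) (\<lambda>x. g x i)"
    and "\<And>x. x \<in> unit_sphere (Suc n) \<Longrightarrow> 0 < (\<Sum>i\<le>Suc n. g x i * h x i)"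
    and "\<And>x. x \<in> unit_sphere (Suc n) \<Longrightarrow> g (- x) = - g x"
    and "\<And>x. x \<in> unit_sphere n \<Longrightarrow> \<exists>i\<le>n. g x i \<noteq> 0"
proof -
  let ?S = "unit_sphere (Suc n)"
  \<comment> \<open>The error budget: the inner product with \<open>h\<close> is 1 at the start,
    loses at most 1/4 to the \<open>n + 2\<close> approximation errors and at most
    \<open>2 * (n + 1) * \<delta>\<close>, again at most 1/4, to the shear. What remains is at least
    1/2.\<close>
  define \<epsilon> where "\<epsilon> = 1 / (4 * (real n + 2))"
  have \<epsilon>: "\<epsilon> > 0" "\<epsilon> \<le> 1" "(real n + 2) * \<epsilon> = 1 / 4"
    by (auto simp: \<epsilon>_def field_simps)
  define \<delta> where "\<delta> = \<epsilon> / 2"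
  have "\<exists>g L. continuous_on ?S g \<and> L \<ge> 0 \<and> coord_lipschitz ?S L g \<and>
    (\<forall>x\<in>?S. \<bar>h x i - g x\<bar> < \<epsilon>) \<and> (\<forall>x\<in>?S. g (- x) = - g x)" for i
  proof -
    have "continuous_on ?S (\<lambda>x. h x i)"
      using h(1) by (rule continuous_on_product_then_coordinatewise)
    moreover have "h (- x) i = - h x i" if "x \<in> ?S" for x
      using odd[OF that] by simp
    ultimately obtain g L where "continuous_on ?S g" "L \<ge> 0" "coord_lipschitz ?S L g"
      "\<And>x. x \<in> ?S \<Longrightarrow> \<bar>h x i - g x\<bar> < \<epsilon>" "\<And>x. x \<in> ?S \<Longrightarrow> g (- x) = - g x"
      using odd_coord_lipschitz_approximation[OF compact_unit_sphere uminus_unit_sphere, of "Suc n" "\<lambda>x. h x i" \<epsilon>] \<epsilon>(1)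
      by metis
    then show ?thesis
      by auto
  qed
  then obtain F M where F: "\<And>i. continuous_on ?S (F i)" "\<And>i. M i \<ge> 0" "\<And>i. coord_lipschitz ?S (M i) (F i)"
    "\<And>i x. x \<in> ?S \<Longrightarrow> \<bar>h x i - F i x\<bar> < \<epsilon>" "\<And>i x. x \<in> ?S \<Longrightarrow> F i (- x) = - F i x"
    by metis
  define L where "L = (\<Sum>i\<le>Suc n. M i) + 1"
  have L: "M i \<le> L" if "i \<le> Suc n" for i
    using member_le_sum[of i "{..Suc n}" M] that F(2) by (auto simp: L_def)
  have "L > 0"
    using sum_nonneg[of "{..Suc n}" M] F(2) by (simp add: L_def)
  have h1: "\<bar>h x i\<bar> \<le> 1" if "x \<in> ?S" for x i
    using h(2) that unit_sphere_bounded by blast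
  have F2: "\<bar>F i x\<bar> \<le> 2" if "x \<in> ?S" for x i
    using F(4)[OF that, of i] h1[OF that, of i] \<epsilon>(2) by linarith
  have Fh: "(\<Sum>i\<le>Suc n. F i x * h x i) \<ge> 3 / 4" if "x \<in> ?S" for x
  proof -
    have "1 - (\<Sum>i\<le>Suc n. \<epsilon>) = (\<Sum>i\<le>Suc n. (h x i)\<^sup>2 - \<epsilon>)"
      using h(2) that by (auto simp: unit_sphere_def sum_subtractf)
    also have "\<dots> \<le> (\<Sum>i\<le>Suc n. F i x * h x i)"
    proof (rule sum_mono)
      fix i
      have "(h x i - F i x) * h x i \<le> \<bar>h x i - F i x\<bar> * \<bar>h x i\<bar>"
        by (metis abs_ge_self abs_mult)
      also have "\<dots> \<le> \<epsilon> * 1"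
        using F(4)[OF that, of i] h1[OF that, of i] \<epsilon>(1) by (intro mult_mono) auto
      finally show "(h x i)\<^sup>2 - \<epsilon> \<le> F i x * h x i"
        by (simp add: algebra_simps power2_eq_square)
    qed
    finally show ?thesis
      using \<epsilon>(3) by (simp add: algebra_simps)
  qed
  \<comment> \<open>Where the last coordinate of \<open>F\<close> is not small, \<Phi> is the affine
    chart for the direction of \<open>F x\<close>: that direction is \<open>(q, 1)\<close> exactly
    when \<open>\<Phi> x i = q i\<close> for all \<open>i \<le> n\<close>.\<close>
  define A where "A = {x \<in> unit_sphere n. 1 / 2 \<le> \<bar>F (Suc n) x\<bar>}"
  define \<Phi> where "\<Phi> x i = F i x / F (Suc n) x" for x i
  have \<Phi>_lipschitz: "\<bar>\<Phi> x i - \<Phi> y i\<bar> \<le> 16 * L * d"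
    if xy: "x \<in> A" "y \<in> A" "i \<le> n" and d: "\<And>j. \<bar>x j - y j\<bar> \<le> d" for x y i d
  proof -
    have xyS: "x \<in> ?S" "y \<in> ?S"
      using xy unit_sphere_subset_Suc by (auto simp: A_def)
    have "d \<ge> 0"
      using d[of 0] by linarith
    have F_close: "\<bar>F j x - F j y\<bar> \<le> L * d" if "j \<le> Suc n" for j
      using coord_lipschitzD[OF F(3) xyS d] mult_right_mono[OF L[OF that] \<open>d \<ge> 0\<close>] by (rule order_trans)
    define b b' where "b = F (Suc n) x" and "b' = F (Suc n) y"
    have b: "1 / 2 \<le> \<bar>b\<bar>" "1 / 2 \<le> \<bar>b'\<bar>"
      using xy by (auto simp: A_def b_def b'_def)
    have "1 / 2 * (1 / 2) \<le> \<bar>b\<bar> * \<bar>b'\<bar>"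
      using b by (intro mult_mono) auto
    have "\<bar>\<Phi> x i - \<Phi> y i\<bar> = \<bar>F i x * b' - F i y * b\<bar> / (\<bar>b\<bar> * \<bar>b'\<bar>)"
      using b by (auto simp: \<Phi>_def b_def[symmetric] b'_def[symmetric] diff_frac_eq abs_divide abs_mult)
    also have "\<dots> \<le> (2 * (L * d) + 2 * (L * d)) / (\<bar>b\<bar> * \<bar>b'\<bar>)"
    proof (intro divide_right_mono abs_mult_diff_le)
      show "\<bar>F i x - F i y\<bar> \<le> L * d"
        using xy(3) by (intro F_close) auto
      show "\<bar>b' - b\<bar> \<le> L * d"
        using F_close[of "Suc n"] by (simp add: b_def b'_def abs_minus_commute)
    qed (use F2 xyS in \<open>auto simp: b_def\<close>)
    also have "\<dots> \<le> (2 * (L * d) + 2 * (L * d)) / (1 / 4)"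
      using \<open>L > 0\<close> \<open>d \<ge> 0\<close> \<open>1 / 2 * (1 / 2) \<le> \<bar>b\<bar> * \<bar>b'\<bar>\<close> by (intro divide_left_mono) auto
    finally show ?thesis
      by (simp add: algebra_simps)
  qed
  obtain q where q: "\<And>i. 0 \<le> q i" "\<And>i. q i \<le> \<delta>" "\<not> (\<exists>x\<in>A. \<forall>i\<le>n. \<Phi> x i = q i)"
  proof -
    obtain cls :: "nat \<Rightarrow> (nat \<Rightarrow> real) \<Rightarrow> nat \<times> bool \<times> (nat \<Rightarrow> int)" and C K where
      cls: "K > 0" "\<And>N. N \<ge> 1 \<Longrightarrow> finite (cls N ` unit_sphere n)"
        "\<And>N. N \<ge> 1 \<Longrightarrow> card (cls N ` unit_sphere n) \<le> C * N ^ n"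
        "\<And>N x y i. N \<ge> 1 \<Longrightarrow> x \<in> unit_sphere n \<Longrightarrow> y \<in> unit_sphere n \<Longrightarrow> cls N x = cls N y \<Longrightarrow>
           \<bar>x i - y i\<bar> \<le> K / real N"
      using unit_sphere_cells[of n] by metis
    have sub: "cls N ` A \<subseteq> cls N ` unit_sphere n" for N
      by (auto simp: A_def)
    show thesis
    proof (rule exists_small_point_outside_image[of "16 * L * K" \<delta> cls A C n \<Phi>])
      show "finite (cls N ` A)" if "N \<ge> 1" for N
        using finite_subset[OF sub cls(2)[OF that]] .
      show "card (cls N ` A) \<le> C * N ^ n" if "N \<ge> 1" for N
        using card_mono[OF cls(2)[OF that] sub] cls(3)[OF that] by (rule order_trans)
      show "\<bar>\<Phi> x i - \<Phi> x' i\<bar> \<le> 16 * L * K / real N"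
        if "N \<ge> 1" "x \<in> A" "x' \<in> A" "cls N x = cls N x'" "i \<le> n" for N x x' i
        using \<Phi>_lipschitz[OF that(2,3,5) cls(4)[OF that(1) _ _ that(4)]] that(2,3) by (simp add: A_def)
    qed (use \<open>L > 0\<close> cls(1) \<epsilon>(1) that in \<open>auto simp: \<delta>_def\<close>)
  qed
  \<comment> \<open>The shear taking the missed direction \<open>(q, 1)\<close> to the last axis, so
    that the axis becomes a missed direction.\<close>
  define g where "g x i = F i x - (if i \<le> n then F (Suc n) x * q i else 0)" for x i
  have gh: "(\<Sum>i\<le>Suc n. g x i * h x i) \<ge> 1 / 2" if x: "x \<in> ?S" for x
  proof -
    have "(\<Sum>i\<le>Suc n. g x i * h x i) = (\<Sum>i\<le>Suc n. F i x * h x i) - F (Suc n) x * (\<Sum>i\<le>n. q i * h x i)"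
      by (simp add: g_def algebra_simps sum_subtractf sum_distrib_left)
    moreover have "F (Suc n) x * (\<Sum>i\<le>n. q i * h x i) \<le> 1 / 4"
    proof -
      have "F (Suc n) x * (\<Sum>i\<le>n. q i * h x i) \<le> \<bar>F (Suc n) x\<bar> * \<bar>\<Sum>i\<le>n. q i * h x i\<bar>"
        by (metis abs_ge_self abs_mult)
      also have "\<bar>\<Sum>i\<le>n. q i * h x i\<bar> \<le> (\<Sum>i\<le>n. \<delta> * 1)"
      proof (intro order_trans[OF sum_abs] sum_mono)
        fix i
        show "\<bar>q i * h x i\<bar> \<le> \<delta> * 1"
          unfolding abs_mult using q(1)[of i] q(2)[of i] h1[OF x, of i] by (intro mult_mono) auto
      qed
      then have "\<bar>F (Suc n) x\<bar> * \<bar>\<Sum>i\<le>n. q i * h x i\<bar> \<le> 2 * ((1 + real n) * \<delta>)"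
        using F2[OF x] by (intro mult_mono) auto
      also have "\<dots> \<le> 1 / 4"
        using \<epsilon> by (simp add: \<delta>_def algebra_simps)
      finally show ?thesis .
    qed
    ultimately show ?thesis
      using Fh[OF x] by linarith
  qed
  show thesis
  proof (rule that[of g])
    show "continuous_on ?S (\<lambda>x. g x i)" for i
      unfolding g_def using F(1) by (cases "i \<le> n") (auto intro!: continuous_intros)
    show "0 < (\<Sum>i\<le>Suc n. g x i * h x i)" if "x \<in> ?S" for x
      using gh[OF that] by linarith
    show "g (- x) = - g x" if "x \<in> ?S" for x
      using F(5)[OF that] by (auto simp: g_def fun_eq_iff)
    show "\<exists>i\<le>n. g x i \<noteq> 0" if x: "x \<in> unit_sphere n" for x
    proof (rule ccontr)
      assume *: "\<not> ?thesis"
      have xS: "x \<in> ?S"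
        using x unit_sphere_subset_Suc by auto
      \<comment> \<open>If \<open>g x\<close> were on the axis, the whole inner product with
        \<open>h x\<close> would come from the last coordinate. This forces \<open>x\<close> into
        \<open>A\<close>, where \<open>q\<close> is avoided.\<close>
      have "1 / 2 \<le> F (Suc n) x * h x (Suc n)"
        using gh[OF xS] * by (simp add: g_def)
      also have "\<dots> \<le> \<bar>F (Suc n) x\<bar> * \<bar>h x (Suc n)\<bar>"
        by (metis abs_ge_self abs_mult)
      also have "\<dots> \<le> \<bar>F (Suc n) x\<bar> * 1"
        using h1[OF xS] by (intro mult_left_mono) auto
      finally have "x \<in> A"
        using x by (simp add: A_def)
      moreover have "\<Phi> x i = q i" if "i \<le> n" for i
        using * that \<open>x \<in> A\<close> by (auto simp: A_def \<Phi>_def g_def)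
      ultimately show False
        using q(3) by blast
    qed
  qed
qed

lemma unit_sphere_Suc_equator: "x \<in> unit_sphere (Suc n) \<Longrightarrow> x (Suc n) = 0 \<Longrightarrow> x \<in> unit_sphere n"
  by (auto simp: unit_sphere_def) (metis Suc_lessI)

lemma unit_sphere_0: "unit_sphere 0 = {\<lambda>i. if i = 0 then 1 else 0, \<lambda>i. if i = 0 then - 1 else 0}"
proof (rule subset_antisym; rule subsetI)
  fix x :: "nat \<Rightarrow> real"
  assume "x \<in> unit_sphere 0"
  then have "x 0 = 1 \<or> x 0 = - 1" "\<And>i. i \<noteq> 0 \<Longrightarrow> x i = 0"
    by (auto simp: unit_sphere_def power2_eq_1_iff)
  then have "x = (\<lambda>i. if i = 0 then 1 else 0) \<or> x = (\<lambda>i. if i = 0 then - 1 else 0)"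
    by (simp add: fun_eq_iff)
  then show "x \<in> {\<lambda>i. if i = 0 then 1 else 0, \<lambda>i. if i = 0 then - 1 else 0}"
    by blast
qed (auto simp: unit_sphere_def)

text \<open>The induction starts at the two-point sphere, where an odd map is the identity or the
  reflection, of degree 1 or -1.\<close>

theorem odd_Brouwer_degree2_odd_map:
  assumes "continuous_on (unit_sphere n) h" "h \<in> unit_sphere n \<rightarrow> unit_sphere n"
    and "\<And>x. x \<in> unit_sphere n \<Longrightarrow> h (- x) = - h x"
  shows "odd (Brouwer_degree2 n h)"
  using assms
proof (induction n arbitrary: h)
  case 0
  define e where "e = (\<lambda>i::nat. if i = 0 then 1 else 0 :: real)"
  have "- e = (\<lambda>i. if i = 0 then - 1 else 0)"
    by (rule ext) (simp add: e_def)
  then have S: "unit_sphere 0 = {e, - e}"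
    by (simp only: unit_sphere_0 e_def)
  have "e \<in> unit_sphere 0"
    by (simp add: S)
  then have he: "h e = e \<or> h e = - e" "h (- e) = - h e"
    using funcset_mem[OF "0.prems"(2)] "0.prems"(3) unfolding S by blast+
  have refl: "(\<lambda>i. if i = 0 then - x i else x i) = - x" if "x \<in> unit_sphere 0" for x
    using that by (auto simp: unit_sphere_def)
  from he(1) show ?case
  proof
    assume "h e = e"
    then have "h x = id x" if "x \<in> unit_sphere 0" for x
      using that he(2) unfolding S by auto
    then have "Brouwer_degree2 0 h = Brouwer_degree2 0 id"
      by (intro Brouwer_degree2_eq) (simp add: topspace_nsphere)
    then show ?thesis by simp
  next
    assume "h e = - e"
    then have "h (- e) = e"
      using he(2) by (simp only: uminus_uminus_fun)
    then have "h x = - x" if "x \<in> unit_sphere 0" for x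
      using that \<open>h e = - e\<close> uminus_uminus_fun[of e] unfolding S by auto
    then have "Brouwer_degree2 0 h = Brouwer_degree2 0 (\<lambda>x i. if i = 0 then - x i else x i)"
      using refl by (intro Brouwer_degree2_eq) (simp add: topspace_nsphere)
    then show ?thesis by (simp add: Brouwer_degree2_reflection)
  qed
next
  case (Suc n)
  let ?S = "unit_sphere (Suc n)"
  obtain g where g: "\<And>i. continuous_on ?S (\<lambda>x. g x i)"
    "\<And>x. x \<in> ?S \<Longrightarrow> 0 < (\<Sum>i\<le>Suc n. g x i * h x i)"
    "\<And>x. x \<in> ?S \<Longrightarrow> g (- x) = - g x" "\<And>x. x \<in> unit_sphere n \<Longrightarrow> \<exists>i\<le>n. g x i \<noteq> 0"
    by (rule odd_perturbation_avoiding_axis[OF Suc.prems]) (assumption, rule that)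
  have g_nz: "\<exists>i\<le>Suc n. g x i \<noteq> 0" if "x \<in> ?S" for x
    using g(2)[OF that] by (metis (no_types, lifting) atMost_iff less_irrefl mult_zero_left sum.neutral)
  \<comment> \<open>The factor is even, so \<open>k\<close> stays odd, and it vanishes on the
    equator, so the equator is preserved. Shrinking one coordinate keeps the inner product with
    \<open>g\<close> positive unless \<open>g x\<close> is on the last axis and \<open>x\<close> on
    the equator, which the choice of \<open>g\<close> excludes.\<close>
  define k where "k x i = (if i \<le> n then g x i else \<bar>x (Suc n)\<bar> * g x i)" for x i
  have k_cont: "continuous_on ?S (\<lambda>x. k x i)" for i
    using g(1) by (cases "i \<le> n")
      (auto simp: k_def intro!: continuous_intros continuous_on_subset[OF continuous_on_product_coordinates])
  have kg: "0 < (\<Sum>i\<le>Suc n. k x i * g x i)" if x: "x \<in> ?S" for x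
  proof (cases "\<exists>i\<le>n. g x i \<noteq> 0")
    case True
    then have "0 < (\<Sum>i\<le>n. (g x i)\<^sup>2)"
      by (rule sum_squares_pos)
    then show ?thesis
      by (simp add: k_def power2_eq_square mult.assoc add_pos_nonneg)
  next
    case False
    then have "x \<notin> unit_sphere n"
      using g(4) by blast
    have "g x (Suc n) \<noteq> 0"
      using False g_nz[OF x] by (metis le_Suc_eq)
    have "x (Suc n) \<noteq> 0"
    proof
      assume "x (Suc n) = 0"
      then have "x \<in> unit_sphere n"
        using x by (rule unit_sphere_Suc_equator[rotated])
      then show False
        using \<open>x \<notin> unit_sphere n\<close> by contradiction
    qed
    then have "0 < \<bar>x (Suc n)\<bar> * (g x (Suc n))\<^sup>2"
      using \<open>g x (Suc n) \<noteq> 0\<close> by simp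
    then show ?thesis
      using False by (simp add: k_def power2_eq_square mult.assoc)
  qed
  have k_nz: "\<exists>i\<le>Suc n. k x i \<noteq> 0" if "x \<in> ?S" for x
    using kg[OF that] by (metis (no_types, lifting) atMost_iff less_irrefl mult_zero_left sum.neutral)
  let ?g = "\<lambda>x. normalize_upto (Suc n) (g x)"
  let ?k = "\<lambda>x. normalize_upto (Suc n) (k x)"
  have k: "continuous_on ?S ?k" "?k \<in> ?S \<rightarrow> ?S"
    using continuous_on_normalize_upto[OF k_cont k_nz] normalize_upto_in_unit_sphere[OF k_nz] by auto
  have k_odd: "?k (- x) = - ?k x" if "x \<in> ?S" for x
  proof -
    have "k (- x) = (\<lambda>i. - k x i)"
      using g(3)[OF that] by (auto simp: k_def fun_eq_iff)
    then show ?thesis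
      by (simp add: normalize_upto_uminus)
  qed
  have k_equator: "?k x \<in> unit_sphere n" if x: "x \<in> unit_sphere n" for x
  proof -
    have "?k x \<in> ?S"
      using k(2) x unit_sphere_subset_Suc by auto
    moreover have "?k x (Suc n) = 0"
      using x by (simp add: normalize_upto_def k_def unit_sphere_def)
    ultimately show ?thesis
      by (rule unit_sphere_Suc_equator)
  qed
  have "Brouwer_degree2 (Suc n) ?k = Brouwer_degree2 (Suc n) ?g"
  proof (rule Brouwer_degree2_normalize_upto)
    show "0 < (\<Sum>i\<le>Suc n. k x i * ?g x i)" if x: "x \<in> ?S" for x
    proof -
      have "(\<Sum>i\<le>Suc n. k x i * ?g x i) = (\<Sum>i\<le>Suc n. k x i * g x i) / sqrt (\<Sum>j\<le>Suc n. (g x j)\<^sup>2)"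
        unfolding sum_divide_distrib by (intro sum.cong) (auto simp: normalize_upto_def)
      then show ?thesis
        using kg[OF x] sum_squares_pos[OF g_nz[OF x]] by simp
    qed
  qed (use continuous_on_normalize_upto[OF g(1) g_nz] normalize_upto_in_unit_sphere[OF g_nz] k_cont in auto)
  also have "\<dots> = Brouwer_degree2 (Suc n) h"
    using Suc.prems(1,2) g(1,2) by (intro Brouwer_degree2_normalize_upto) auto
  finally have deg: "Brouwer_degree2 (Suc n) h = Brouwer_degree2 (Suc n) ?k" ..
  have "even (Brouwer_degree2 (Suc n) ?k - Brouwer_degree2 (Suc n - Suc 0) ?k)"
  proof (rule Borsuk_odd_mapping_degree_step)
    show "continuous_map (nsphere (Suc n)) (nsphere (Suc n)) ?k"
      using k by (simp add: continuous_map_nsphere_iff)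
    show "(?k \<circ> (\<lambda>x i. - x i)) u = ((\<lambda>x i. - x i) \<circ> ?k) u" if "u \<in> topspace (nsphere (Suc n))" for u
      using k_odd[of u] that by (simp only: topspace_nsphere o_apply fun_Compl_def)
    show "?k \<in> topspace (nsphere (Suc n - Suc 0)) \<rightarrow> topspace (nsphere (Suc n - Suc 0))"
      using k_equator by (simp add: topspace_nsphere)
  qed
  moreover have "odd (Brouwer_degree2 n ?k)"
  proof (rule Suc.IH)
    show "continuous_on (unit_sphere n) ?k"
      using k(1) unit_sphere_subset_Suc by (rule continuous_on_subset)
    show "?k \<in> unit_sphere n \<rightarrow> unit_sphere n"
      using k_equator by blast
    show "?k (- x) = - ?k x" if "x \<in> unit_sphere n" for x
      using that unit_sphere_subset_Suc k_odd by blast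
  qed
  ultimately show ?case
    by (simp add: deg)
qed

text \<open>Without a common zero, \<open>G\<close> padded by a zero coordinate and normalized would
  be an odd self-map of the sphere with values in the equator. It is not surjective, so its degree
  is 0, which is not odd.\<close>

theorem Borsuk_Ulam:
  fixes G :: "(nat \<Rightarrow> real) \<Rightarrow> nat \<Rightarrow> real"
  assumes cont: "\<And>i. i < n \<Longrightarrow> continuous_on (unit_sphere n) (\<lambda>x. G x i)"
    and odd: "\<And>x i. x \<in> unit_sphere n \<Longrightarrow> i < n \<Longrightarrow> G (- x) i = - G x i"
  obtains x where "x \<in> unit_sphere n" "\<And>i. i < n \<Longrightarrow> G x i = 0"
proof (rule ccontr)
  assume "\<not> thesis"
  then have nz: "\<exists>i<n. G x i \<noteq> 0" if "x \<in> unit_sphere n" for x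
    using \<open>\<And>x. \<lbrakk>x \<in> unit_sphere n; \<And>i. i < n \<Longrightarrow> G x i = 0\<rbrakk> \<Longrightarrow> thesis\<close> that by blast
  define k where "k x i = (if i < n then G x i else 0)" for x i
  have k_nz: "\<exists>i\<le>n. k x i \<noteq> 0" if "x \<in> unit_sphere n" for x
    using nz[OF that] by (auto simp: k_def)
  have k_cont: "continuous_on (unit_sphere n) (\<lambda>x. k x i)" for i
    using cont by (cases "i < n") (auto simp: k_def)
  let ?k = "\<lambda>x. normalize_upto n (k x)"
  have k: "continuous_on (unit_sphere n) ?k" "?k \<in> unit_sphere n \<rightarrow> unit_sphere n"
    using continuous_on_normalize_upto[OF k_cont k_nz] normalize_upto_in_unit_sphere[OF k_nz] by auto
  have "?k (- x) = - ?k x" if "x \<in> unit_sphere n" for x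
  proof -
    have "k (- x) = (\<lambda>i. - k x i)"
      using odd[OF that] by (auto simp: k_def fun_eq_iff)
    then show ?thesis
      by (simp add: normalize_upto_uminus)
  qed
  then have "odd (Brouwer_degree2 n ?k)"
    by (rule odd_Brouwer_degree2_odd_map[OF k])
  moreover have "Brouwer_degree2 n ?k = 0"
  proof (rule Brouwer_degree2_nonsurjective)
    define e where "e = (\<lambda>i. if i = n then 1 else 0 :: real)"
    have "e \<in> unit_sphere n"
      by (simp add: e_def unit_sphere_def if_distrib[of "\<lambda>t. t\<^sup>2"] cong: if_cong)
    moreover have "e n \<noteq> ?k x n" for x
      by (simp add: e_def normalize_upto_def k_def)
    ultimately show "?k ` topspace (nsphere n) \<noteq> topspace (nsphere n)"
      unfolding topspace_nsphere by (metis imageE)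
  qed (use k in \<open>simp add: continuous_map_nsphere_iff\<close>)
  ultimately show False by simp
qed

section \<open>Covering dimension\<close>

text \<open>If every member of the cover lies in an open half-space \<open>\<plusminus> x i > 0\<close>, a partition of unity yields
  a self-map of the sphere homotopic to the identity. At a point lying in at most \<open>n\<close> members, one of
  the \<open>n + 1\<close> coordinates of this map vanishes, so it would not be surjective.\<close>

lemma unit_sphere_cover_multiplicity:
  assumes fin: "finite \<V>"
    and op: "\<And>V. V \<in> \<V> \<Longrightarrow> openin (top_of_set (unit_sphere n)) V"
    and cover: "unit_sphere n \<subseteq> \<Union>\<V>"
    and small: "\<And>V. V \<in> \<V> \<Longrightarrow> \<exists>i\<le>n. (\<forall>x\<in>V. 0 < x i) \<or> (\<forall>x\<in>V. x i < 0)"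
  obtains x where "x \<in> unit_sphere n" "Suc n \<le> card {V \<in> \<V>. x \<in> V}"
proof (rule ccontr)
  let ?S = "unit_sphere n"
  assume "\<not> thesis"
  then have few: "card {V \<in> \<V>. x \<in> V} \<le> n" if "x \<in> ?S" for x
    using that \<open>\<And>x. \<lbrakk>x \<in> unit_sphere n; Suc n \<le> card {V \<in> \<V>. x \<in> V}\<rbrakk> \<Longrightarrow> thesis\<close> not_less_eq_eq
    by blast
  have "\<exists>i s. i \<le> n \<and> (\<forall>x\<in>V. 0 < s * x i)" if V: "V \<in> \<V>" for V
  proof -
    obtain i where i: "i \<le> n" and dis: "(\<forall>x\<in>V. 0 < x i) \<or> (\<forall>x\<in>V. x i < 0)"
      using small[OF V] by blast
    from dis show ?thesis
    proof
      assume "\<forall>x\<in>V. 0 < x i"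
      then show ?thesis
        using i by (intro exI[of _ i] exI[of _ 1]) simp
    next
      assume "\<forall>x\<in>V. x i < 0"
      then show ?thesis
        using i by (intro exI[of _ i] exI[of _ "- 1"]) simp
    qed
  qed
  then obtain ix :: "(nat \<Rightarrow> real) set \<Rightarrow> nat" and s :: "(nat \<Rightarrow> real) set \<Rightarrow> real"
    where ix: "\<And>V. V \<in> \<V> \<Longrightarrow> ix V \<le> n" and s: "\<And>V x. V \<in> \<V> \<Longrightarrow> x \<in> V \<Longrightarrow> 0 < s V * x (ix V)"
    by metis
  \<comment> \<open>The distance to the complement. The case distinction is forced by
    \<open>infdist\<close> to the empty set being 0.\<close>
  define \<rho> where "\<rho> V x = (if ?S \<subseteq> V then 1 else infdist x (?S - V))" for V x
  have \<rho>_cont: "continuous_on ?S (\<rho> V)" for V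
    by (cases "?S \<subseteq> V") (auto simp: \<rho>_def[abs_def] intro!: continuous_intros)
  have \<rho>_nonneg: "0 \<le> \<rho> V x" for V x
    by (simp add: \<rho>_def infdist_nonneg)
  have \<rho>_zero: "\<rho> V x = 0" if "x \<in> ?S" "x \<notin> V" for V x
    using that by (auto simp: \<rho>_def)
  have \<rho>_pos: "0 < \<rho> V x" if "V \<in> \<V>" "x \<in> V" for V x
  proof (cases "?S \<subseteq> V")
    case False
    have "closedin (top_of_set ?S) (?S - V)"
      using closedin_diff[OF closedin_subtopology_refl[THEN iffD2] op[OF that(1)]] by simp
    then have "closed (?S - V)"
      using closedin_closed_trans compact_imp_closed[OF compact_unit_sphere] by blast
    then show ?thesis
      using False that(2) by (auto simp: \<rho>_def intro!: infdist_pos_not_in_closed)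
  qed (simp add: \<rho>_def)
  \<comment> \<open>Each member \<open>V\<close> containing \<open>x\<close> contributes a multiple
    of the axis vector of index \<open>ix V\<close>, signed by \<open>s V\<close> so as to have
    positive inner product with \<open>x\<close>. Hence \<open>g x\<close> is never opposite to
    \<open>x\<close>.\<close>
  define g where "g x i = (\<Sum>V\<in>\<V>. \<rho> V x * (if ix V = i then s V else 0))" for x i
  have g_cont: "continuous_on ?S (\<lambda>x. g x i)" for i
    unfolding g_def using \<rho>_cont by (intro continuous_intros) auto
  have g_pos: "0 < (\<Sum>i\<le>n. g x i * id x i)" if x: "x \<in> ?S" for x
  proof -
    have "(\<Sum>i\<le>n. g x i * id x i) = (\<Sum>V\<in>\<V>. \<Sum>i\<le>n. \<rho> V x * (if ix V = i then s V else 0) * x i)"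
      unfolding g_def sum_distrib_right by (subst sum.swap) simp
    also have "\<dots> = (\<Sum>V\<in>\<V>. \<rho> V x * (s V * x (ix V)))"
    proof (rule sum.cong[OF refl])
      fix V assume "V \<in> \<V>"
      have "(\<Sum>i\<le>n. \<rho> V x * (if ix V = i then s V else 0) * x i) =
            (\<Sum>i\<le>n. if ix V = i then \<rho> V x * (s V * x i) else 0)"
        by (intro sum.cong) auto
      then show "(\<Sum>i\<le>n. \<rho> V x * (if ix V = i then s V else 0) * x i) = \<rho> V x * (s V * x (ix V))"
        using ix[OF \<open>V \<in> \<V>\<close>] by simp
    qed
    also have "0 < \<dots>"
    proof -
      obtain W where W: "W \<in> \<V>" "x \<in> W"
        using cover x by auto
      show ?thesis
      proof (rule sum_pos2[OF fin W(1)])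
        show "0 < \<rho> W x * (s W * x (ix W))"
          using \<rho>_pos[OF W] s[OF W] by simp
        show "0 \<le> \<rho> V x * (s V * x (ix V))" if "V \<in> \<V>" for V
          using \<rho>_nonneg[of V x] \<rho>_zero[OF x, of V] s[OF that, of x] by (cases "x \<in> V") auto
      qed
    qed
    finally show ?thesis .
  qed
  have g_nz: "\<exists>i\<le>n. g x i \<noteq> 0" if "x \<in> ?S" for x
  proof (rule ccontr)
    assume "\<not> ?thesis"
    then have "(\<Sum>i\<le>n. g x i * id x i) = 0"
      by (intro sum.neutral) auto
    then show False
      using g_pos[OF that] by simp
  qed
  have g_zero: "\<exists>i\<le>n. g x i = 0" if x: "x \<in> ?S" for x
  proof -
    have "card (ix ` {V \<in> \<V>. x \<in> V}) \<le> n"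
      using card_image_le[of "{V \<in> \<V>. x \<in> V}" ix] few[OF x] fin by simp
    then have "\<not> {..n} \<subseteq> ix ` {V \<in> \<V>. x \<in> V}"
      using card_mono[of "ix ` {V \<in> \<V>. x \<in> V}" "{..n}"] fin by auto
    then obtain i where i: "i \<le> n" "\<And>V. V \<in> \<V> \<Longrightarrow> x \<in> V \<Longrightarrow> ix V \<noteq> i"
      by auto
    then have "g x i = 0"
      unfolding g_def using \<rho>_zero[OF x] by (intro sum.neutral) auto
    then show ?thesis
      using i(1) by blast
  qed
  let ?g = "\<lambda>x. normalize_upto n (g x)"
  have "Brouwer_degree2 n ?g = Brouwer_degree2 n id"
    by (rule Brouwer_degree2_normalize_upto[OF continuous_on_id' _ g_cont g_pos, unfolded id_def[symmetric]]) auto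
  moreover have "Brouwer_degree2 n ?g = 0"
  proof (rule Brouwer_degree2_nonsurjective)
    show "continuous_map (nsphere n) (nsphere n) ?g"
      using continuous_on_normalize_upto[OF g_cont g_nz] normalize_upto_in_unit_sphere[OF g_nz]
      by (simp add: continuous_map_nsphere_iff)
    \<comment> \<open>A point without vanishing coordinates is not in the image.\<close>
    define e where "e = normalize_upto n (\<lambda>_. 1)"
    have "e \<in> ?S"
      unfolding e_def by (rule normalize_upto_in_unit_sphere) auto
    moreover have "e \<notin> ?g ` ?S"
    proof
      assume "e \<in> ?g ` ?S"
      then obtain x where x: "x \<in> ?S" "e = ?g x"
        by auto
      obtain i where "i \<le> n" "g x i = 0"
        using g_zero[OF x(1)] by blast
      then have "e i = 0"
        by (simp add: x(2) normalize_upto_def)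
      then show False
        using \<open>i \<le> n\<close> by (simp add: e_def normalize_upto_def)
    qed
    ultimately show "?g ` topspace (nsphere n) \<noteq> topspace (nsphere n)"
      unfolding topspace_nsphere by blast
  qed
  ultimately show False by simp
qed

section \<open>Upper bound for the dimension: stars of grid cells\<close>

lemma dist_fun_le:
  fixes x y :: "'i::countable \<Rightarrow> 'b::metric_space"
  assumes "\<And>i. dist (x i) (y i) \<le> c"
  shows "dist x y \<le> 2 * c"
proof -
  have "c \<ge> 0"
    using assms zero_le_dist order_trans by blast
  have "dist x y \<le> suminf (\<lambda>n. c * (1 / 2) ^ n)"
    unfolding dist_fun_def
  proof (rule suminf_le)
    show "(1 / 2) ^ n * min (dist (x (from_nat n)) (y (from_nat n))) 1 \<le> c * (1 / 2) ^ n" for n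
      using assms[of "from_nat n"] by (simp add: min_def field_simps)
    show "summable (\<lambda>n. (1 / 2) ^ n * min (dist (x (from_nat n)) (y (from_nat n))) 1)"
      by (rule summable_comparison_test'[of "\<lambda>n. (1/2)^n"]) (auto simp: summable_geometric_iff)
    show "summable (\<lambda>n. c * (1 / 2) ^ n :: real)"
      by (intro summable_mult summable_geometric) simp
  qed
  \<comment> \<open>The factor 2 is the sum of the weights \<open>(1 / 2) ^ n\<close> in the metric
    of the function type.\<close>
  also have "\<dots> = 2 * c"
    using suminf_geometric[of "1/2::real"] by (simp add: suminf_mult summable_geometric)
  finally show ?thesis .
qed

text \<open>The open star of a cell of the grid of mesh \<open>1/N\<close>: the cell has the free coordinates \<open>E\<close>, and
  \<open>a\<close> records its position. At a point of the star the free coordinates are farther from the grid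
  than the other ones.\<close>

definition grid_star :: "(nat \<Rightarrow> real) set \<Rightarrow> nat \<Rightarrow> nat \<Rightarrow> nat set \<Rightarrow> (nat \<Rightarrow> int) \<Rightarrow> (nat \<Rightarrow> real) set" where
  "grid_star K M N E a = {x \<in> K.
     (\<forall>m\<in>E. a m < N * x m \<and> N * x m < real_of_int (a m) + 1) \<and>
     (\<forall>k\<in>{..<M} - E. \<bar>N * x k - a k\<bar> < 1 / 2) \<and>
     (\<forall>m\<in>E. \<forall>k\<in>{..<M} - E. \<bar>N * x k - a k\<bar> < N * x m - a m \<and> \<bar>N * x k - a k\<bar> < real_of_int (a m) + 1 - N * x m)}"

lemma openin_grid_star:
  assumes "finite E"
  shows "openin (top_of_set K) (grid_star K M N E a)"
proof -
  have ball: "open {x. \<forall>i\<in>A. P i x}" if "finite A" "\<And>i. i \<in> A \<Longrightarrow> open {x. P i x}"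
    for A and P :: "nat \<Rightarrow> (nat \<Rightarrow> real) \<Rightarrow> bool"
    using that by (simp add: Collect_ball_eq open_INT)
  define P where "P x \<longleftrightarrow> (\<forall>m\<in>E. a m < N * x m \<and> N * x m < real_of_int (a m) + 1) \<and>
     (\<forall>k\<in>{..<M} - E. \<bar>N * x k - a k\<bar> < 1 / 2) \<and>
     (\<forall>m\<in>E. \<forall>k\<in>{..<M} - E. \<bar>N * x k - a k\<bar> < N * x m - a m \<and> \<bar>N * x k - a k\<bar> < real_of_int (a m) + 1 - N * x m)"
    for x :: "nat \<Rightarrow> real"
  have "open {x. P x}"
    unfolding P_def using assms
    by (intro open_Collect_conj ball open_Collect_less continuous_intros continuous_on_product_coordinates) auto
  then have "openin (top_of_set K) (K \<inter> {x. P x})"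
    by (rule openin_open_Int)
  moreover have "grid_star K M N E a = K \<inter> {x. P x}"
    by (auto simp only: grid_star_def P_def)
  ultimately show ?thesis
    by simp
qed

text \<open>Different sets of free coordinates of equal size would give an \<open>m\<close> free
  only for the first cell and a \<open>k\<close> free only for the second. At \<open>x\<close> each
  of the two coordinates would then be strictly nearer to the grid than the other. Once the free
  coordinates agree, the positions are determined by integer parts and nearest integers.\<close>

lemma grid_star_eqI:
  assumes sub: "E \<subseteq> {..<M}" "E' \<subseteq> {..<M}" and card: "card E = card E'"
    and x: "x \<in> grid_star K M N E a" "x \<in> grid_star K M N E' a'"
  shows "grid_star K M N E a = grid_star K M N E' a'"
proof -
  define y where "y k = N * x k" for k
  have fin: "finite E" "finite E'"
    using sub finite_subset by auto
  have E: "a m < y m" "y m < a m + 1" if "m \<in> E" for m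
    using x(1) that by (auto simp: grid_star_def y_def)
  have E': "a' m < y m" "y m < a' m + 1" if "m \<in> E'" for m
    using x(2) that by (auto simp: grid_star_def y_def)
  have near: "\<bar>y k - a k\<bar> < 1 / 2" if "k < M" "k \<notin> E" for k
    using x(1) that by (auto simp: grid_star_def y_def)
  have near': "\<bar>y k - a' k\<bar> < 1 / 2" if "k < M" "k \<notin> E'" for k
    using x(2) that by (auto simp: grid_star_def y_def)
  \<comment> \<open>A free coordinate lies between two consecutive integers, so the two inequalities
    in the star bound its distance to every integer \<open>b\<close>. This allows a comparison with
    the position \<open>a'\<close> of the other cell.\<close>
  have less: "\<bar>y k - a k\<bar> < \<bar>y m - b\<bar>" if "m \<in> E" "k < M" "k \<notin> E" for m k and b :: int
  proof -
    have "\<bar>y k - a k\<bar> < y m - a m" "\<bar>y k - a k\<bar> < a m + 1 - y m"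
      using x(1) that by (auto simp: grid_star_def y_def)
    then show ?thesis
      using E[OF that(1)] by (cases "b \<le> a m") linarith+
  qed
  have less': "\<bar>y k - a' k\<bar> < \<bar>y m - b\<bar>" if "m \<in> E'" "k < M" "k \<notin> E'" for m k and b :: int
  proof -
    have "\<bar>y k - a' k\<bar> < y m - a' m" "\<bar>y k - a' k\<bar> < a' m + 1 - y m"
      using x(2) that by (auto simp: grid_star_def y_def)
    then show ?thesis
      using E'[OF that(1)] by (cases "b \<le> a' m") linarith+
  qed
  have "E \<subseteq> E'"
  proof (rule ccontr)
    assume "\<not> E \<subseteq> E'"
    then have "\<not> E' \<subseteq> E"
      using card card_subset_eq[OF fin(1)] by auto
    then obtain m k where mk: "m \<in> E" "m \<notin> E'" "k \<in> E'" "k \<notin> E"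
      using \<open>\<not> E \<subseteq> E'\<close> by auto
    then show False
      using less[of m k "a' m"] less'[of k m "a k"] sub by force
  qed
  then have "E = E'"
    using card card_subset_eq[OF fin(2)] by auto
  moreover have "a m = a' m" if "m < M" for m
  proof (cases "m \<in> E")
    case True
    then have "real_of_int (a m) < a' m + 1" "real_of_int (a' m) < a m + 1"
      using E[of m] E'[of m] \<open>E = E'\<close> by auto
    then show ?thesis by linarith
  next
    case False
    then have "\<bar>y m - a m\<bar> < 1 / 2" "\<bar>y m - a' m\<bar> < 1 / 2"
      using near[OF that] near'[OF that] \<open>E = E'\<close> by auto
    then show ?thesis by linarith
  qed
  ultimately show ?thesis
    using sub by (auto simp: grid_star_def subset_iff)
qed

text \<open>The stars of cells of equal dimension are disjoint, so a point lies in at most one star for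
  each of the dimensions \<open>0, \<dots>, D\<close>.\<close>

lemma low_multiplicity_refinement:
  fixes K :: "(nat \<Rightarrow> real) set"
  assumes K: "compact K" "\<And>x m. x \<in> K \<Longrightarrow> M \<le> m \<Longrightarrow> x m = 0"
    and dim: "\<And>x. x \<in> K \<Longrightarrow> card {m. x m \<notin> \<int>} \<le> D"
    and \<U>: "\<And>U. U \<in> \<U> \<Longrightarrow> openin (top_of_set K) U" "K \<subseteq> \<Union>\<U>"
  obtains \<V> where "finite \<V>" "\<And>V. V \<in> \<V> \<Longrightarrow> openin (top_of_set K) V" "K = \<Union>\<V>"
    "\<And>V. V \<in> \<V> \<Longrightarrow> \<exists>U\<in>\<U>. V \<subseteq> U" "\<And>x. x \<in> K \<Longrightarrow> card {V \<in> \<V>. x \<in> V} \<le> Suc D"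
proof -
  obtain T where T: "\<And>U. U \<in> \<U> \<Longrightarrow> open (T U)" "\<And>U. U \<in> \<U> \<Longrightarrow> U = K \<inter> T U"
    using \<U>(1) unfolding openin_open by metis
  \<comment> \<open>A Lebesgue number of the cover.\<close>
  obtain \<epsilon> where \<epsilon>: "0 < \<epsilon>" "\<And>x. x \<in> K \<Longrightarrow> \<exists>G\<in>T ` \<U>. ball x \<epsilon> \<subseteq> G"
  proof (rule Heine_Borel_lemma[OF K(1), of "T ` \<U>"])
    show "K \<subseteq> \<Union>(T ` \<U>)"
      using \<U>(2) T(2) by fastforce
  qed (use T(1) in auto)
  obtain N :: nat where N: "2 / \<epsilon> < N"
    using reals_Archimedean2 by blast
  have "0 < 2 / \<epsilon>"
    using \<epsilon>(1) by simp
  then have "0 < real N"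
    using N by linarith
  \<comment> \<open>\<open>W y\<close> is the star of the cell with \<open>y\<close> in its relative
    interior. An integer coordinate remains one after multiplication by \<open>N\<close>, so the
    cell has at most as many free coordinates as \<open>y\<close> has fractional ones, hence
    dimension at most \<open>D\<close>.\<close>
  define E where "E y = {m. N * y m \<notin> \<int>}" for y :: "nat \<Rightarrow> real"
  define W where "W y = grid_star K M N (E y) (\<lambda>m. \<lfloor>N * y m\<rfloor>)" for y :: "nat \<Rightarrow> real"
  have E_sub: "E y \<subseteq> {..<M}" if "y \<in> K" for y
    using K(2)[OF that] by (force simp: E_def not_less[symmetric])
  then have E_fin: "finite (E y)" if "y \<in> K" for y
    using that finite_subset by blast
  have E_card: "card (E y) \<le> D" if "y \<in> K" for y
  proof -
    have "{m. y m \<notin> \<int>} \<subseteq> {..<M}"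
      using K(2)[OF that] by (force simp: not_less[symmetric])
    then have "finite {m. y m \<notin> \<int>}"
      using finite_subset by blast
    moreover have "E y \<subseteq> {m. y m \<notin> \<int>}"
      by (auto simp: E_def)
    ultimately show ?thesis
      using card_mono dim[OF that] order_trans by blast
  qed
  have floor_E: "real_of_int \<lfloor>N * y m\<rfloor> < N * y m" "N * y m < real_of_int \<lfloor>N * y m\<rfloor> + 1"
    if "m \<in> E y" for y :: "nat \<Rightarrow> real" and m
  proof -
    have "real_of_int \<lfloor>N * y m\<rfloor> \<noteq> N * y m"
    proof
      assume "real_of_int \<lfloor>N * y m\<rfloor> = N * y m"
      then have "N * y m \<in> \<int>"
        by (rule subst[of _ _ "\<lambda>t. t \<in> \<int>"]) (rule Ints_of_int)
      then show False
        using that by (simp add: E_def)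
    qed
    then show "real_of_int \<lfloor>N * y m\<rfloor> < N * y m" "N * y m < real_of_int \<lfloor>N * y m\<rfloor> + 1"
      by linarith+
  qed
  have floor_not_E: "real_of_int \<lfloor>N * y m\<rfloor> = N * y m" if "m \<notin> E y"
    for y :: "nat \<Rightarrow> real" and m
    using that by (simp add: E_def)
  have mem: "y \<in> W y" if "y \<in> K" for y
  proof -
    have on_grid: "\<bar>N * y k - real_of_int \<lfloor>N * y k\<rfloor>\<bar> = 0" if "k \<notin> E y" for k
      by (simp only: floor_not_E[OF that] diff_self abs_zero)
    have off_grid: "0 < N * y m - real_of_int \<lfloor>N * y m\<rfloor>" "0 < real_of_int \<lfloor>N * y m\<rfloor> + 1 - N * y m"
      if "m \<in> E y" for m
      using floor_E[OF that] by linarith+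
    show ?thesis
      unfolding W_def grid_star_def mem_Collect_eq
      using that floor_E[of _ y] off_grid on_grid by (intro conjI ballI) (simp_all only: Diff_iff, simp_all)
  qed
  have W_small: "dist y x < \<epsilon>" if "y \<in> K" "x \<in> W y" for x y
  proof -
    have "x \<in> K"
      using that(2) by (simp add: W_def grid_star_def)
    have "\<bar>N * y m - N * x m\<bar> \<le> 1" for m
    proof (cases "m \<in> E y")
      case True
      then have "real_of_int \<lfloor>N * y m\<rfloor> < N * x m" "N * x m < real_of_int \<lfloor>N * y m\<rfloor> + 1"
        using that(2) by (auto simp: W_def grid_star_def)
      then show ?thesis
        using floor_E[OF True] by linarith
    next
      case False
      show ?thesis
      proof (cases "m < M")
        case True
        then have "\<bar>N * x m - real_of_int \<lfloor>N * y m\<rfloor>\<bar> < 1 / 2"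
          using that(2) False by (auto simp: W_def grid_star_def)
        then show ?thesis
          using floor_not_E[OF False] by linarith
      next
        case False
        then show ?thesis
          using K(2)[OF that(1)] K(2)[OF \<open>x \<in> K\<close>] by simp
      qed
    qed
    then have "N * \<bar>y m - x m\<bar> \<le> 1" for m
      by (simp add: abs_mult flip: right_diff_distrib)
    then have "dist y x \<le> 2 * (1 / N)"
      using \<open>0 < real N\<close> by (intro dist_fun_le) (simp add: dist_real_def field_simps)
    also have "\<dots> < \<epsilon>"
      using N \<epsilon>(1) \<open>0 < real N\<close> by (simp add: field_simps)
    finally show ?thesis .
  qed
  have "\<exists>\<V>\<subseteq>W ` K. finite \<V> \<and> K \<subseteq> \<Union>\<V>"
    using K(1) mem E_fin unfolding compact_eq_openin_cover
    by (elim allE[of _ "W ` K"]) (auto simp: W_def intro: openin_grid_star)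
  then obtain \<V> where \<V>: "\<V> \<subseteq> W ` K" "finite \<V>" "K \<subseteq> \<Union>\<V>"
    by auto
  have "\<forall>V\<in>\<V>. \<exists>y. y \<in> K \<and> V = W y"
    using \<V>(1) by blast
  then obtain y where "\<forall>V\<in>\<V>. y V \<in> K \<and> V = W (y V)"
    by (rule bchoice[THEN exE])
  then have y: "\<And>V. V \<in> \<V> \<Longrightarrow> y V \<in> K" "\<And>V. V \<in> \<V> \<Longrightarrow> V = W (y V)"
    by blast+
  show thesis
  proof (rule that[OF \<V>(2)])
    show op: "openin (top_of_set K) V" if "V \<in> \<V>" for V
      by (subst y(2)[OF that], subst W_def) (rule openin_grid_star[OF E_fin[OF y(1)[OF that]]])
    show "K = \<Union>\<V>"
      using \<V>(3) op openin_imp_subset by blast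
    show "\<exists>U\<in>\<U>. V \<subseteq> U" if V: "V \<in> \<V>" for V
    proof -
      obtain U where "U \<in> \<U>" "ball (y V) \<epsilon> \<subseteq> T U"
        using \<epsilon>(2)[OF y(1)[OF V]] by auto
      moreover have "V \<subseteq> K"
        using op[OF V] openin_imp_subset by blast
      moreover have "V \<subseteq> ball (y V) \<epsilon>"
        using W_small[OF y(1)[OF V]] y(2)[OF V] by auto
      ultimately show ?thesis
        using T(2) by blast
    qed
    show "card {V \<in> \<V>. x \<in> V} \<le> Suc D" if "x \<in> K" for x
    proof -
      have "inj_on (\<lambda>V. card (E (y V))) {V \<in> \<V>. x \<in> V}"
      proof (rule inj_onI)
        fix V V' assume V: "V \<in> {V \<in> \<V>. x \<in> V}" "V' \<in> {V \<in> \<V>. x \<in> V}"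
          and "card (E (y V)) = card (E (y V'))"
        then have "W (y V) = W (y V')"
          unfolding W_def using y E_sub by (intro grid_star_eqI[of _ _ _ x]) (auto simp: W_def)
        then show "V = V'"
          using V y(2) by auto
      qed
      then have "card {V \<in> \<V>. x \<in> V} \<le> card {..D}"
        using E_card y(1) by (intro card_inj_on_le) auto
      then show ?thesis by simp
    qed
  qed
qed

section \<open>The van Kampen-Flores theorem\<close>

text \<open>The join of \<open>D + 1\<close> copies of a three-point space:
  the three coordinates of each block \<open>{3j, 3j + 1, 3j + 2}\<close> stand for the three points of one copy.
  Normalizing the maximal coordinate (rather than the sum) to \<open>1\<close> makes it a cubical complex.\<close>

definition flores_complex :: "nat \<Rightarrow> (nat \<Rightarrow> real) set" where
  "flores_complex D = {x. (\<forall>m. 0 \<le> x m \<and> x m \<le> 1) \<and> (\<forall>m\<ge>3 * Suc D. x m = 0) \<and>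
     (\<forall>m m'. m \<noteq> m' \<longrightarrow> m div 3 = m' div 3 \<longrightarrow> x m = 0 \<or> x m' = 0) \<and> (\<exists>m. x m = 1)}"

lemma flores_complexD:
  assumes "x \<in> flores_complex D"
  shows "0 \<le> x m" "x m \<le> 1" "3 * Suc D \<le> m \<Longrightarrow> x m = 0"
    "m \<noteq> m' \<Longrightarrow> m div 3 = m' div 3 \<Longrightarrow> x m = 0 \<or> x m' = 0" "\<exists>m. x m = 1"
  using assms by (auto simp: flores_complex_def)

lemma div_3_le_iff: "m div 3 \<le> D \<longleftrightarrow> m < 3 * Suc D" for m D :: nat
  by presburger

lemma compact_flores_complex: "compact (flores_complex D)"
proof -
  have eq: "flores_complex D = {x. \<forall>m. x m \<in> {0..1}} \<inter> ((\<Inter>m\<in>{3 * Suc D..}. {x. x m = 0}) \<inter>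
      ((\<Inter>m. \<Inter>m'\<in>{m'. m \<noteq> m' \<and> m div 3 = m' div 3}. {x. x m = 0} \<union> {x. x m' = 0}) \<inter>
       (\<Union>m\<in>{..<3 * Suc D}. {x. x m = 1})))" (is "_ = ?R")
  proof (rule subset_antisym; rule subsetI)
    fix x assume x: "x \<in> flores_complex D"
    then obtain m where "x m = 1"
      using flores_complexD(5) by blast
    moreover have "m < 3 * Suc D"
      using flores_complexD(3)[OF x, of m] \<open>x m = 1\<close> by (cases "m < 3 * Suc D") auto
    ultimately show "x \<in> ?R"
      using flores_complexD(1-3)[OF x] by (auto dest: flores_complexD(4)[OF x])
  next
    fix x assume "x \<in> ?R"
    then show "x \<in> flores_complex D"
      unfolding flores_complex_def by auto
  qed
  have cl: "closed {x::nat \<Rightarrow> real. x m = c}" for m c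
    by (intro closed_Collect_eq continuous_intros continuous_on_product_coordinates)
  show ?thesis
    unfolding eq
    by (intro compact_Int_closed compact_PiE_UNIV closed_Int closed_INT closed_UN closed_Un ballI cl) auto
qed

text \<open>Each of the \<open>D + 1\<close> blocks has at most one nonzero coordinate, and in a
  block where the value 1 is attained that coordinate is not fractional. The normalization by the
  maximum thus removes one dimension.\<close>

lemma flores_complex_fractional_coordinates:
  assumes x: "x \<in> flores_complex D"
  shows "card {m. x m \<notin> \<int>} \<le> D"
proof -
  obtain m0 where m0: "x m0 = 1"
    using flores_complexD(5)[OF x] by blast
  have nz: "x m \<noteq> 0" "x m \<noteq> 1" if "x m \<notin> \<int>" for m
    using that by auto
  have le: "m div 3 \<le> D" if "x m \<noteq> 0" for m
    unfolding div_3_le_iff using flores_complexD(3)[OF x, of m] that by (meson not_less)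
  have "card {m. x m \<notin> \<int>} \<le> card ({..D} - {m0 div 3})"
  proof (rule card_inj_on_le)
    show "inj_on (\<lambda>m. m div 3) {m. x m \<notin> \<int>}"
      using flores_complexD(4)[OF x] nz by (auto intro!: inj_onI)
    show "(\<lambda>m. m div 3) ` {m. x m \<notin> \<int>} \<subseteq> {..D} - {m0 div 3}"
    proof clarify
      fix m assume m: "x m \<notin> \<int>"
      then have "m \<noteq> m0"
        using m0 by auto
      then have "m div 3 \<noteq> m0 div 3"
        using flores_complexD(4)[OF x, of m m0] nz(1)[OF m] m0 by auto
      then show "m div 3 \<in> {..D} - {m0 div 3}"
        using le[OF nz(1)[OF m]] by simp
    qed
  qed simp
  also have "\<dots> = D"
    using le[of m0] m0 by simp
  finally show ?thesis .
qed

text \<open>Using only two of the three points in each block, the complex contains a copy of the cross-polytope,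
  that is a \<open>D\<close>-sphere.\<close>

definition cross_polytope_map :: "nat \<Rightarrow> (nat \<Rightarrow> real) \<Rightarrow> nat \<Rightarrow> real" where
  "cross_polytope_map D y m =
     (if m mod 3 = 0 then min 1 (max 0 ((real D + 1) * y (m div 3)))
      else if m mod 3 = 1 then min 1 (max 0 (- ((real D + 1) * y (m div 3)))) else 0)"

text \<open>Some coordinate of \<open>y\<close> has modulus at least \<open>1 / (D + 1)\<close>;
  scaling by \<open>D + 1\<close> and truncating at 1 therefore attains the maximum 1 without a
  division. The truncation may identify points, but it preserves the signs, and only these matter
  for covers.\<close>

lemma cross_polytope_map_in_flores_complex:
  assumes y: "y \<in> unit_sphere D"
  shows "cross_polytope_map D y \<in> flores_complex D"
proof -
  obtain j where j: "j \<le> D" "1 / (real D + 1) \<le> \<bar>y j\<bar>"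
    using ex_large_coordinate_unit_sphere[OF y] .
  have "1 \<le> (real D + 1) * \<bar>y j\<bar>"
    using j(2) by (simp add: field_simps)
  moreover have "(3 * j + 1) div 3 = j" "(3 * j + 1) mod 3 = 1"
    by presburger+
  ultimately have "cross_polytope_map D y (3 * j) = 1 \<or> cross_polytope_map D y (3 * j + 1) = 1"
    by (cases "y j \<ge> 0") (auto simp: cross_polytope_map_def)
  then have "\<exists>m. cross_polytope_map D y m = 1"
    by blast
  moreover have "cross_polytope_map D y m = 0" if "3 * Suc D \<le> m" for m
  proof -
    have "D < m div 3"
      using that div_3_le_iff[of m D] by linarith
    then have "y (m div 3) = 0"
      using y by (simp add: unit_sphere_def)
    then show ?thesis
      by (simp add: cross_polytope_map_def)
  qed
  moreover have "cross_polytope_map D y m = 0 \<or> cross_polytope_map D y m' = 0"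
    if "m \<noteq> m'" "m div 3 = m' div 3" for m m'
  proof -
    have "m mod 3 \<noteq> m' mod 3"
      using that by (metis div_mult_mod_eq)
    moreover have "cross_polytope_map D y k = 0" if "0 \<le> y (k div 3)" "k mod 3 \<noteq> 0" for k
      using that by (simp add: cross_polytope_map_def)
    moreover have "cross_polytope_map D y k = 0" if "y (k div 3) \<le> 0" "k mod 3 \<noteq> 1" for k
      using that by (simp add: cross_polytope_map_def mult_nonneg_nonpos)
    ultimately show ?thesis
      using that(2) by (metis linear zero_neq_one)
  qed
  moreover have "0 \<le> cross_polytope_map D y m \<and> cross_polytope_map D y m \<le> 1" for m
    by (simp add: cross_polytope_map_def)
  ultimately show ?thesis
    unfolding flores_complex_def by blast
qed

lemma continuous_on_cross_polytope_map: "continuous_on S (cross_polytope_map D)"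
proof (rule continuous_on_coordinatewise_then_product)
  fix m
  have "continuous_on S (\<lambda>y::nat \<Rightarrow> real. y (m div 3))"
    by (rule continuous_on_subset[OF continuous_on_product_coordinates]) auto
  then show "continuous_on S (\<lambda>y. cross_polytope_map D y m)"
    unfolding cross_polytope_map_def
    by (cases "m mod 3 = 0"; cases "m mod 3 = 1") (auto intro!: continuous_intros)
qed

text \<open>The cover is pulled back to the sphere, where positivity of coordinate \<open>m\<close>
  of the complex becomes a sign condition on coordinate \<open>m div 3\<close>.\<close>

lemma flores_complex_cover_multiplicity:
  assumes fin: "finite \<V>"
    and op: "\<And>V. V \<in> \<V> \<Longrightarrow> openin (top_of_set (flores_complex D)) V"
    and cover: "flores_complex D \<subseteq> \<Union>\<V>"
    and small: "\<And>V. V \<in> \<V> \<Longrightarrow> \<exists>m<3 * Suc D. \<forall>x\<in>V. 0 < x m"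
  obtains x where "x \<in> flores_complex D" "Suc D \<le> card {V \<in> \<V>. x \<in> V}"
proof -
  let ?\<sigma> = "cross_polytope_map D"
  define pre where "pre V = unit_sphere D \<inter> ?\<sigma> -` V" for V
  obtain y where y: "y \<in> unit_sphere D" "Suc D \<le> card {W \<in> pre ` \<V>. y \<in> W}"
  proof (rule unit_sphere_cover_multiplicity[of "pre ` \<V>" D])
    show "openin (top_of_set (unit_sphere D)) W" if W: "W \<in> pre ` \<V>" for W
    proof -
      obtain V where "V \<in> \<V>" "W = pre V"
        using W by blast
      then show ?thesis
        using continuous_openin_preimage[OF continuous_on_cross_polytope_map _ op]
          cross_polytope_map_in_flores_complex by (simp add: pre_def Pi_iff)
    qed
    show "unit_sphere D \<subseteq> \<Union>(pre ` \<V>)"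
      using cover cross_polytope_map_in_flores_complex by (fastforce simp: pre_def)
    show "\<exists>i\<le>D. (\<forall>x\<in>W. 0 < x i) \<or> (\<forall>x\<in>W. x i < 0)" if W: "W \<in> pre ` \<V>" for W
    proof -
      obtain V where V: "V \<in> \<V>" "W = pre V"
        using W by blast
      obtain m where m: "m < 3 * Suc D" "\<And>x. x \<in> V \<Longrightarrow> 0 < x m"
        using small[OF V(1)] by blast
      have pos: "0 < ?\<sigma> x m" if "x \<in> W" for x
        using that m(2) by (auto simp: V(2) pre_def)
      have sign: "0 < x (m div 3)" if "x \<in> W" "m mod 3 = 0" for x
      proof -
        have "0 < (real D + 1) * x (m div 3)"
          using pos[OF that(1)] that(2) by (simp add: cross_polytope_map_def less_max_iff_disj)
        then show ?thesis
          by (simp add: zero_less_mult_iff)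
      qed
      \<comment> \<open>For \<open>m mod 3 = 2\<close> the map is 0 at \<open>m\<close>, so
        \<open>W\<close> is empty and the claim is vacuous.\<close>
      have sign': "x (m div 3) < 0" if "x \<in> W" "m mod 3 \<noteq> 0" for x
      proof -
        have "(real D + 1) * x (m div 3) < 0"
          using pos[OF that(1)] that(2) by (simp add: cross_polytope_map_def less_max_iff_disj split: if_splits)
        then show ?thesis
          by (simp add: mult_less_0_iff)
      qed
      have "m div 3 \<le> D"
        using m(1) by (simp only: div_3_le_iff)
      then show ?thesis
        using sign sign' by (cases "m mod 3 = 0") blast+
    qed
  qed (use fin that in auto)
  \<comment> \<open>Distinct members may have equal preimages, so pulling back can only lower the
    multiplicity.\<close>
  have "{W \<in> pre ` \<V>. y \<in> W} \<subseteq> pre ` {V \<in> \<V>. ?\<sigma> y \<in> V}"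
    by (auto simp: pre_def)
  then have "card {W \<in> pre ` \<V>. y \<in> W} \<le> card {V \<in> \<V>. ?\<sigma> y \<in> V}"
    using fin by (intro order_trans[OF card_mono card_image_le]) auto
  then show thesis
    using that[OF cross_polytope_map_in_flores_complex[OF y(1)]] y(2) by simp
qed

text \<open>The part of a plane vector \<open>(a, b)\<close> in the direction of one of the three points of a block:
  with \<open>l = (a, b, - a - b)\<close>, this is the amount by which \<open>l i\<close> exceeds the other two entries.
  The map sending \<open>z\<close> to the three parts of \<open>z\<close> and of \<open>-z\<close> identifies the rays of the plane with
  the points of the hexagon that is the deleted join of three points with themselves.\<close>

definition hexagon_part :: "real \<Rightarrow> real \<Rightarrow> nat \<Rightarrow> real" where
  "hexagon_part a b i =
     max 0 (if i = 0 then min (a - b) (2 * a + b)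
            else if i = 1 then min (b - a) (a + 2 * b) else min (- 2 * a - b) (- a - 2 * b))"

lemma hexagon_part_nonneg: "0 \<le> hexagon_part a b i"
  by (simp add: hexagon_part_def)

lemma hexagon_part_eq_0_iff:
  "hexagon_part a b 0 = 0 \<longleftrightarrow> a \<le> b \<or> 2 * a + b \<le> 0"
  "hexagon_part a b 1 = 0 \<longleftrightarrow> b \<le> a \<or> a + 2 * b \<le> 0"
  "hexagon_part a b 2 = 0 \<longleftrightarrow> 0 \<le> 2 * a + b \<or> 0 \<le> a + 2 * b"
  by (simp_all add: hexagon_part_def max_def min_def) linarith+

lemma less_3_cases: "i = 0 \<or> i = 1 \<or> i = 2" if "i < 3" for i :: nat
  using that by linarith

lemma hexagon_part_exclusive:
  assumes "i < 3" "i' < 3" "i \<noteq> i'"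
  shows "hexagon_part a b i = 0 \<or> hexagon_part a b i' = 0"
proof -
  have "hexagon_part a b 0 = 0 \<or> hexagon_part a b 1 = 0"
    "hexagon_part a b 0 = 0 \<or> hexagon_part a b 2 = 0"
    "hexagon_part a b 1 = 0 \<or> hexagon_part a b 2 = 0"
    unfolding hexagon_part_eq_0_iff by linarith+
  then show ?thesis
    using less_3_cases[OF assms(1)] less_3_cases[OF assms(2)] assms(3) by blast
qed

text \<open>No entry of a triple is both its strict maximum and its strict minimum.\<close>

lemma hexagon_part_antipodal:
  assumes "i < 3"
  shows "hexagon_part a b i = 0 \<or> hexagon_part (- a) (- b) i = 0"
proof -
  have "hexagon_part a b 0 = 0 \<or> hexagon_part (- a) (- b) 0 = 0"
    "hexagon_part a b 1 = 0 \<or> hexagon_part (- a) (- b) 1 = 0"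
    "hexagon_part a b 2 = 0 \<or> hexagon_part (- a) (- b) 2 = 0"
    unfolding hexagon_part_eq_0_iff by linarith+
  then show ?thesis
    using less_3_cases[OF assms] by blast
qed

text \<open>The maximum and the minimum of the triple \<open>(a, b, - a - b)\<close> are both
  attained at least twice, so its entries are all equal; their sum is 0.\<close>

lemma hexagon_part_eq_0D:
  assumes "\<And>i. i < 3 \<Longrightarrow> hexagon_part a b i = 0" "\<And>i. i < 3 \<Longrightarrow> hexagon_part (- a) (- b) i = 0"
  shows "a = 0 \<and> b = 0"
proof -
  have "hexagon_part a b 0 = 0" "hexagon_part a b 1 = 0" "hexagon_part a b 2 = 0"
    "hexagon_part (- a) (- b) 0 = 0" "hexagon_part (- a) (- b) 1 = 0" "hexagon_part (- a) (- b) 2 = 0"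
    using assms by auto
  then show ?thesis
    unfolding hexagon_part_eq_0_iff by linarith
qed

lemma continuous_on_hexagon_part:
  "continuous_on S f \<Longrightarrow> continuous_on S g \<Longrightarrow> continuous_on S (\<lambda>x. hexagon_part (f x) (g x) i)"
  unfolding hexagon_part_def by (cases "i = 0"; cases "i = 1") (auto intro!: continuous_intros)

text \<open>The sphere of dimension \<open>2 * D + 1\<close> lies in a sum of \<open>D + 1\<close>
  planes, one for each block. Up to scaling, the values at \<open>y\<close> and at
  \<open>- y\<close> are the two halves of a point of the deleted join, and the antipodal map
  exchanges them.\<close>

definition cone_coordinates :: "(nat \<Rightarrow> real) \<Rightarrow> nat \<Rightarrow> real" where
  "cone_coordinates y m = hexagon_part (y (2 * (m div 3))) (y (2 * (m div 3) + 1)) (m mod 3)"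

lemma continuous_on_cone_coordinates: "continuous_on S (\<lambda>y. cone_coordinates y m)"
  unfolding cone_coordinates_def
  by (intro continuous_on_hexagon_part continuous_on_subset[OF continuous_on_product_coordinates]) auto

lemma cone_coordinates_eq_0:
  assumes "y \<in> unit_sphere (2 * D + 1)" "3 * Suc D \<le> m"
  shows "cone_coordinates y m = 0"
proof -
  have "D < m div 3"
    using assms(2) div_3_le_iff[of m D] by linarith
  then show ?thesis
    using assms(1) by (simp add: cone_coordinates_def unit_sphere_def hexagon_part_def)
qed

lemma cone_coordinates_exclusive:
  assumes "m \<noteq> m'" "m div 3 = m' div 3"
  shows "cone_coordinates y m = 0 \<or> cone_coordinates y m' = 0"
proof -
  have "m mod 3 \<noteq> m' mod 3"
    using assms by (metis div_mult_mod_eq)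
  then show ?thesis
    using hexagon_part_exclusive[of "m mod 3" "m' mod 3"] assms(2) by (simp add: cone_coordinates_def)
qed

lemma cone_coordinates_antipodal: "cone_coordinates y m = 0 \<or> cone_coordinates (- y) m = 0"
  using hexagon_part_antipodal[of "m mod 3"] by (simp add: cone_coordinates_def)

lemma ex_cone_coordinates_nonzero:
  assumes y: "y \<in> unit_sphere (2 * D + 1)"
  shows "\<exists>m<3 * Suc D. cone_coordinates y m \<noteq> 0 \<or> cone_coordinates (- y) m \<noteq> 0"
proof (rule ccontr)
  assume *: "\<not> ?thesis"
  obtain k where k: "k \<le> 2 * D + 1" "y k \<noteq> 0"
    using unit_sphere_nonzero[OF y] by blast
  define j where "j = k div 2"
  have "j \<le> D"
    using k(1) by (simp add: j_def)
  have zero: "cone_coordinates y (3 * j + i) = 0 \<and> cone_coordinates (- y) (3 * j + i) = 0" if "i < 3" for i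
  proof -
    have "3 * j + i < 3 * Suc D"
      using that \<open>j \<le> D\<close> by simp
    then show ?thesis
      using * by blast
  qed
  have eq: "cone_coordinates z (3 * j + i) = hexagon_part (z (2 * j)) (z (2 * j + 1)) i" if "i < 3" for i z
    using that by (simp add: cone_coordinates_def)
  have "y (2 * j) = 0 \<and> y (2 * j + 1) = 0"
  proof (rule hexagon_part_eq_0D)
    fix i :: nat assume "i < 3"
    then show "hexagon_part (y (2 * j)) (y (2 * j + 1)) i = 0"
      using zero[of i] eq[of i y] by simp
    show "hexagon_part (- y (2 * j)) (- y (2 * j + 1)) i = 0"
      using zero[of i] eq[of i "- y"] \<open>i < 3\<close> by simp
  qed
  moreover have "k = 2 * j \<or> k = 2 * j + 1"
    by (auto simp: j_def)
  ultimately show False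
    using k(2) by auto
qed

text \<open>The deleted join of the complex with itself is a \<open>(2 D + 1)\<close>-sphere,
  and \<open>t x \<oplus> (1 - t) y \<mapsto> (t f x - (1 - t) f y, 2 t - 1)\<close> is an odd map from it to
  the space of dimension \<open>2 D + 1\<close>.
  To avoid dividing by \<open>t\<close> and \<open>1 - t\<close>, \<open>f\<close> is extended to the whole space and evaluated at
  truncated cone coordinates; only the places where \<open>t\<close> and \<open>1 - t\<close> agree matter.\<close>

theorem van_Kampen_Flores:
  fixes f :: "(nat \<Rightarrow> real) \<Rightarrow> nat \<Rightarrow> real"
  assumes f: "\<And>i. i < 2 * D \<Longrightarrow> continuous_on (flores_complex D) (\<lambda>x. f x i)"
  obtains x y where "x \<in> flores_complex D" "y \<in> flores_complex D"
    "\<And>i. i < 2 * D \<Longrightarrow> f x i = f y i" "\<And>m. x m = 0 \<or> y m = 0"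
proof -
  let ?K = "flores_complex D"
  let ?S = "unit_sphere (2 * D + 1)"
  have "\<exists>F. continuous_on UNIV F \<and> (\<forall>x\<in>?K. F x = f x i)" if i: "i < 2 * D" for i
  proof -
    have "bounded ((\<lambda>x. f x i) ` ?K)"
      by (intro compact_imp_bounded compact_continuous_image f[OF i] compact_flores_complex)
    then obtain B where "0 < B \<and> (\<forall>z\<in>(\<lambda>x. f x i) ` ?K. norm z \<le> B)"
      unfolding bounded_pos by (rule exE)
    then have B: "0 < B" "\<And>x. x \<in> ?K \<Longrightarrow> norm (f x i) \<le> B"
      by simp_all
    obtain F where "continuous_on UNIV F" "\<And>x. x \<in> ?K \<Longrightarrow> F x = f x i"
    proof (rule Tietze[OF f[OF i], of UNIV B])
      show "closedin (top_of_set UNIV) ?K"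
        using compact_imp_closed[OF compact_flores_complex] by simp
      show "0 \<le> B"
        using B(1) by simp
    qed (erule B(2), rule that)
    then show ?thesis
      by blast
  qed
  then obtain F where F: "\<And>i. i < 2 * D \<Longrightarrow> continuous_on UNIV (F i)"
    "\<And>i x. i < 2 * D \<Longrightarrow> x \<in> ?K \<Longrightarrow> F i x = f x i"
    by metis
  \<comment> \<open>\<open>N y\<close> and \<open>N (- y)\<close> play the parts of \<open>t\<close>
    and \<open>1 - t\<close>.\<close>
  define N where "N y = (\<Sum>m<3 * Suc D. cone_coordinates y m)" for y
  have N_cont: "continuous_on ?S N"
    unfolding N_def[abs_def] by (intro continuous_intros continuous_on_cone_coordinates)
  have minus_cont: "continuous_on ?S (\<lambda>y. - y)" "(\<lambda>y. - y) \<in> ?S \<rightarrow> ?S"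
    using uminus_unit_sphere by (auto intro: continuous_on_uminus_fun[OF continuous_on_id])
  have N_cont': "continuous_on ?S (\<lambda>y. N (- y))"
    using minus_cont(2) by (intro continuous_on_compose2[OF N_cont minus_cont(1)]) auto
  have N_pos: "0 < N y + N (- y)" if y: "y \<in> ?S" for y
  proof -
    obtain m where "m < 3 * Suc D" "cone_coordinates y m + cone_coordinates (- y) m > 0"
    proof -
      obtain m where "m < 3 * Suc D" "cone_coordinates y m \<noteq> 0 \<or> cone_coordinates (- y) m \<noteq> 0"
        using ex_cone_coordinates_nonzero[OF y] by blast
      moreover have "0 \<le> cone_coordinates z m" for z
        by (simp add: cone_coordinates_def hexagon_part_nonneg)
      ultimately show thesis
        using that[of m] by (metis add_nonneg_pos add_pos_nonneg less_eq_real_def)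
    qed
    then show ?thesis
      unfolding N_def sum.distrib[symmetric]
      by (intro sum_pos2[of _ m]) (auto simp: cone_coordinates_def hexagon_part_nonneg)
  qed
  \<comment> \<open>By compactness the sum stays away from 0, so both weights are at least
    \<open>c\<close> wherever they agree.\<close>
  obtain c where c: "0 < c" "\<And>y. y \<in> ?S \<Longrightarrow> 2 * c \<le> N y + N (- y)"
  proof -
    have "?S \<noteq> {}"
      using in_topspace_nsphere by (metis empty_iff topspace_nsphere)
    then obtain y0 where y0: "y0 \<in> ?S" "\<And>y. y \<in> ?S \<Longrightarrow> N y0 + N (- y0) \<le> N y + N (- y)"
      using continuous_attains_inf[OF compact_unit_sphere _ continuous_on_add[OF N_cont N_cont']] by blast
    show thesis
    proof (rule that[of "(N y0 + N (- y0)) / 2"])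
      show "0 < (N y0 + N (- y0)) / 2"
        using N_pos[OF y0(1)] by simp
      show "2 * ((N y0 + N (- y0)) / 2) \<le> N y + N (- y)" if "y \<in> ?S" for y
        using y0(2)[OF that] by simp
    qed
  qed
  \<comment> \<open>Among the \<open>3 * Suc D\<close> coordinates with sum at least
    \<open>c\<close>, one is at least \<open>d\<close>. Dividing by \<open>d\<close> and truncating
    at 1 thus produces a coordinate equal to 1, as membership in the complex requires.\<close>
  define d where "d = c / (3 * Suc D)"
  have "d > 0"
    using c(1) by (simp add: d_def)
  define Q where "Q y m = min 1 (cone_coordinates y m / d)" for y m
  have Q_cont: "continuous_on ?S Q"
  proof (rule continuous_on_coordinatewise_then_product)
    show "continuous_on ?S (\<lambda>y. Q y m)" for m
      unfolding Q_def using \<open>d > 0\<close> by (intro continuous_intros continuous_on_cone_coordinates) auto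
  qed
  have Q_cont': "continuous_on ?S (\<lambda>y. Q (- y))"
    using minus_cont(2) by (intro continuous_on_compose2[OF Q_cont minus_cont(1)]) auto
  have Q_in: "Q y \<in> ?K" if y: "y \<in> ?S" "c \<le> N y" for y
  proof -
    have "\<exists>m<3 * Suc D. d \<le> cone_coordinates y m"
    proof (rule ccontr)
      assume "\<not> ?thesis"
      then have "N y < (\<Sum>m<3 * Suc D. d)"
        unfolding N_def by (intro sum_strict_mono) (auto simp: lessThan_empty_iff)
      also have "\<dots> = c"
        by (simp add: d_def del: sum.lessThan_Suc)
      finally show False
        using y(2) by simp
    qed
    then have "\<exists>m. Q y m = 1"
      using \<open>d > 0\<close> by (auto simp: Q_def min_def)
    moreover have "Q y m = 0" if "cone_coordinates y m = 0" for m
      using that by (simp add: Q_def)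
    moreover have "0 \<le> Q y m \<and> Q y m \<le> 1" for m
      using \<open>d > 0\<close> by (simp add: Q_def cone_coordinates_def hexagon_part_nonneg)
    ultimately show ?thesis
      unfolding flores_complex_def using cone_coordinates_eq_0[OF y(1)] cone_coordinates_exclusive by blast
  qed
  define G where "G y i = (if i < 2 * D then F i (Q y) - F i (Q (- y)) else N y - N (- y))" for y i
  obtain y where y: "y \<in> ?S" "\<And>i. i < 2 * D + 1 \<Longrightarrow> G y i = 0"
  proof (rule Borsuk_Ulam[of "2 * D + 1" G])
    show "continuous_on ?S (\<lambda>y. G y i)" for i
    proof (cases "i < 2 * D")
      case True
      then show ?thesis
        using continuous_on_compose2[OF F(1)[OF True] Q_cont] continuous_on_compose2[OF F(1)[OF True] Q_cont']
        by (auto simp: G_def intro!: continuous_on_diff)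
    next
      case False
      then show ?thesis
        unfolding G_def using N_cont N_cont' by (auto intro!: continuous_on_diff)
    qed
    show "G (- y) i = - G y i" for y i
      by (simp add: G_def uminus_uminus_fun)
  qed (use that in blast)
  have "N y = N (- y)"
    using y(2)[of "2 * D"] by (simp add: G_def)
  then have "c \<le> N y" "c \<le> N (- y)"
    using c(2)[OF y(1)] by auto
  then have Q_mem: "Q y \<in> ?K" "Q (- y) \<in> ?K"
    using Q_in y(1) uminus_unit_sphere by blast+
  show thesis
  proof (rule that[OF Q_mem])
    show "f (Q y) i = f (Q (- y)) i" if "i < 2 * D" for i
      using y(2)[of i] that F(2)[OF that] Q_mem by (simp add: G_def)
    show "Q y m = 0 \<or> Q (- y) m = 0" for m
      using cone_coordinates_antipodal[of y m] by (auto simp: Q_def)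
  qed
qed

section \<open>Dynamical dimension of the identity\<close>

lemma space_borel_of: "space (borel_of X) = topspace X"
  unfolding borel_of_def by (rule space_measure_of) (auto dest: openin_subset)

lemma openin_in_sets_borel_of: "openin X U \<Longrightarrow> U \<in> sets (borel_of X)"
  unfolding borel_of_def by (subst sets_measure_of) (auto dest: openin_subset)

lemma ord_cover_le:
  assumes "\<And>x. x \<in> topspace X \<Longrightarrow> card {V \<in> \<V>. x \<in> V} \<le> Suc D"
  shows "ord_cover X T \<V> \<le> of_nat D"
  unfolding ord_cover_def
proof (rule SUP_least)
  fix M assume "M \<in> invariant_prob_measures X T"
  then have M: "prob_space M" "sets M = sets (borel_of X)"
    by (auto simp: invariant_prob_measures_def)
  have space: "space M = topspace X"
    using sets_eq_imp_space_eq[OF M(2)] by (simp add: space_borel_of)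
  have "(\<integral>\<^sup>+x. ennreal (ord_at \<V> x) \<partial>M) \<le> (\<integral>\<^sup>+x. of_nat D \<partial>M)"
  proof (rule nn_integral_mono)
    fix x assume "x \<in> space M"
    then have "ord_at \<V> x \<le> real D"
      using assms[of x] by (simp add: ord_at_def space)
    then show "ennreal (ord_at \<V> x) \<le> of_nat D"
      by (metis ennreal_leI ennreal_of_nat_eq_real_of_nat)
  qed
  also have "\<dots> = of_nat D"
    using prob_space.emeasure_space_1[OF M(1)] by simp
  finally show "(\<integral>\<^sup>+x. ennreal (ord_at \<V> x) \<partial>M) \<le> of_nat D" .
qed

text \<open>The point mass at \<open>x\<close> is invariant under the identity, so the supremum over
  measures dominates the order at the single point \<open>x\<close>.\<close>

lemma ord_cover_id_ge:
  assumes \<V>: "finite \<V>" "\<And>V. V \<in> \<V> \<Longrightarrow> openin X V"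
    and x: "x \<in> topspace X" "Suc D \<le> card {V \<in> \<V>. x \<in> V}"
  shows "of_nat D \<le> ord_cover X id \<V>"
proof -
  let ?M = "return (borel_of X) x"
  have M: "?M \<in> invariant_prob_measures X id"
    using x(1) by (auto simp: invariant_prob_measures_def space_borel_of id_def intro!: prob_space_return)
  \<comment> \<open>On this open neighbourhood of \<open>x\<close> the order is at least
    \<open>D\<close>, so the integral can be bounded below by that of an indicator, whose
    measurability is clear.\<close>
  define A where "A = topspace X \<inter> \<Inter>{V \<in> \<V>. x \<in> V}"
  have "{V \<in> \<V>. x \<in> V} \<noteq> {}"
    using x(2) by force
  then have "openin X A"
    unfolding A_def using \<V> by (intro openin_Int openin_Inter) auto
  have "x \<in> A"
    using x(1) by (auto simp: A_def)
  have "of_nat D * indicator A z \<le> ennreal (ord_at \<V> z)" for z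
  proof (cases "z \<in> A")
    case True
    then have "card {V \<in> \<V>. x \<in> V} \<le> card {V \<in> \<V>. z \<in> V}"
      using \<V>(1) by (intro card_mono) (auto simp: A_def)
    then have "real D \<le> ord_at \<V> z"
      using x(2) by (simp add: ord_at_def)
    then have "ennreal (real D) \<le> ennreal (ord_at \<V> z)"
      by (rule ennreal_leI)
    then show ?thesis
      using True by (simp add: ennreal_of_nat_eq_real_of_nat)
  qed simp
  then have "(\<integral>\<^sup>+z. of_nat D * indicator A z \<partial>?M) \<le> (\<integral>\<^sup>+z. ennreal (ord_at \<V> z) \<partial>?M)"
    by (intro nn_integral_mono)
  moreover have "(\<integral>\<^sup>+z. of_nat D * indicator A z \<partial>?M) = of_nat D"
    using openin_in_sets_borel_of[OF \<open>openin X A\<close>] \<open>x \<in> A\<close>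
    by (simp add: nn_integral_cmult_indicator)
  ultimately show ?thesis
    unfolding ord_cover_def using M by (auto intro: SUP_upper2)
qed

lemma flores_complex_nonempty: "flores_complex D \<noteq> {}"
proof -
  have "(\<lambda>m. if m = 0 then 1 else 0) \<in> flores_complex D"
    by (auto simp: flores_complex_def)
  then show ?thesis by blast
qed

lemma topological_dynamical_system_flores_complex:
  "topological_dynamical_system (top_of_set (flores_complex D)) id"
  unfolding topological_dynamical_system_def
  using compact_flores_complex flores_complex_nonempty
  by (auto intro: metrizable_space_subtopology metrizable_space_euclidean compact_space_subtopology)

lemma dynamical_dim_flores_complex:
  "dynamical_dim (top_of_set (flores_complex D)) id = of_nat D"
proof (rule antisym)
  let ?K = "flores_complex D"
  let ?X = "top_of_set ?K"
  show "dynamical_dim ?X id \<le> of_nat D"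
    unfolding dynamical_dim_def
  proof (rule SUP_least)
    fix \<U> assume "\<U> \<in> finite_open_covers ?X"
    then have \<U>: "\<And>U. U \<in> \<U> \<Longrightarrow> openin ?X U" "?K \<subseteq> \<Union>\<U>"
      by (auto simp: finite_open_covers_def)
    obtain \<V> where \<V>: "finite \<V>" "\<And>V. V \<in> \<V> \<Longrightarrow> openin ?X V" "?K = \<Union>\<V>"
      "\<And>V. V \<in> \<V> \<Longrightarrow> \<exists>U\<in>\<U>. V \<subseteq> U" "\<And>x. x \<in> ?K \<Longrightarrow> card {V \<in> \<V>. x \<in> V} \<le> Suc D"
    proof (rule low_multiplicity_refinement[of ?K "3 * Suc D" D \<U>])
      show "x m = 0" if "x \<in> ?K" "3 * Suc D \<le> m" for x m
        using that by (rule flores_complexD(3))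
    qed (assumption | rule compact_flores_complex flores_complex_fractional_coordinates \<U> that)+
    have "\<V> \<in> {\<V> \<in> finite_open_covers ?X. cover_refines \<V> \<U>}"
      using \<V> by (auto simp: finite_open_covers_def cover_refines_def)
    moreover have "ord_cover ?X id \<V> \<le> of_nat D"
      using \<V>(5) by (intro ord_cover_le) auto
    ultimately show "dynamical_dim_cover ?X id \<U> \<le> of_nat D"
      unfolding dynamical_dim_cover_def by (rule INF_lower2)
  qed
  \<comment> \<open>In a refinement of this cover every member has a coordinate that is positive
    throughout, which is what the lower bound on multiplicity asks for.\<close>
  define \<U> where "\<U> = (\<lambda>m. ?K \<inter> {x. 0 < x m}) ` {..<3 * Suc D}"
  have "openin ?X (?K \<inter> {x. 0 < x m})" for m
    by (intro openin_open_Int open_Collect_less continuous_intros continuous_on_product_coordinates)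
  moreover have "\<exists>m<3 * Suc D. 0 < x m" if x: "x \<in> ?K" for x
  proof -
    obtain m where m: "x m = 1"
      using flores_complexD(5)[OF x] by blast
    then have "m < 3 * Suc D"
      using flores_complexD(3)[OF x, of m] by (cases "m < 3 * Suc D") auto
    then show ?thesis
      using m by (intro exI[of _ m]) simp
  qed
  ultimately have "\<U> \<in> finite_open_covers ?X"
    unfolding finite_open_covers_def \<U>_def by fastforce
  moreover have "of_nat D \<le> dynamical_dim_cover ?X id \<U>"
    unfolding dynamical_dim_cover_def
  proof (rule INF_greatest)
    fix \<V> assume "\<V> \<in> {\<V> \<in> finite_open_covers ?X. cover_refines \<V> \<U>}"
    then have \<V>: "finite \<V>" "\<And>V. V \<in> \<V> \<Longrightarrow> openin ?X V" "?K \<subseteq> \<Union>\<V>"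
      and small: "\<And>V. V \<in> \<V> \<Longrightarrow> \<exists>U\<in>\<U>. V \<subseteq> U"
      by (auto simp: finite_open_covers_def cover_refines_def)
    have "\<exists>m<3 * Suc D. \<forall>x\<in>V. 0 < x m" if "V \<in> \<V>" for V
      using small[OF that] unfolding \<U>_def by blast
    then obtain x where "x \<in> ?K" "Suc D \<le> card {V \<in> \<V>. x \<in> V}"
      using flores_complex_cover_multiplicity[OF \<V>] by blast
    then show "of_nat D \<le> ord_cover ?X id \<V>"
      using \<V> by (intro ord_cover_id_ge[of _ _ x]) auto
  qed
  ultimately show "of_nat D \<le> dynamical_dim ?X id"
    unfolding dynamical_dim_def by (rule SUP_upper2)
qed

lemma shift_map_fixed_point:
  assumes "shift_map z = z"
  shows "z k = z 0"
proof (induction k rule: int_induct[of _ 0])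
  case (step1 i)
  then show ?case
    using fun_cong[OF assms, of i] by (simp add: shift_map_def)
next
  case (step2 i)
  then show ?case
    using fun_cong[OF assms, of "i - 1"] by (simp add: shift_map_def)
qed simp

lemma flores_complex_no_equivariant_embedding:
  "\<not> equivariant_embedding (top_of_set (flores_complex D)) id (cubical_shift_topology (2 * D)) shift_map F"
proof
  let ?K = "flores_complex D"
  let ?Y = "cubical_shift_topology (2 * D)"
  assume "equivariant_embedding (top_of_set ?K) id ?Y shift_map F"
  then have emb: "embedding_map (top_of_set ?K) ?Y F" and fixed: "\<And>x. x \<in> ?K \<Longrightarrow> shift_map (F x) = F x"
    by (auto simp: equivariant_embedding_def)
  have cont: "continuous_map (top_of_set ?K) ?Y F" and inj: "inj_on F ?K"
    using emb by (auto simp: embedding_map_def homeomorphic_eq_everything_map continuous_map_in_subtopology)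
  have cont0: "continuous_map (top_of_set ?K) (unit_cube_topology (2 * D)) (\<lambda>x. F x 0)"
    using cont unfolding cubical_shift_topology_def by (simp add: continuous_map_componentwise)
  have "continuous_on ?K (\<lambda>x. F x 0 i)" if "i < 2 * D" for i
  proof -
    have "continuous_map (top_of_set ?K) (top_of_set {0..1}) (\<lambda>x. F x 0 i)"
      using cont0 that unfolding unit_cube_topology_def by (simp add: continuous_map_componentwise)
    then show ?thesis
      by (simp add: continuous_map_in_subtopology)
  qed
  then obtain x y where xy: "x \<in> ?K" "y \<in> ?K" "\<And>i. i < 2 * D \<Longrightarrow> F x 0 i = F y 0 i" "\<And>m. x m = 0 \<or> y m = 0"
    using van_Kampen_Flores[of D "\<lambda>x. F x 0"] by blast
  \<comment> \<open>Points of the cube have a fixed value outside the index set, so agreement of the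
    \<open>2 * D\<close> coordinates is equality.\<close>
  have ext: "F z 0 \<in> extensional {..<2 * D}" if "z \<in> ?K" for z
    using continuous_map_funspace[OF cont0] that by (auto simp: unit_cube_topology_def PiE_def)
  have "F x 0 = F y 0"
    using xy(3) by (intro extensionalityI[OF ext[OF xy(1)] ext[OF xy(2)]]) auto
  then have "F x k = F y k" for k
    using shift_map_fixed_point[OF fixed[OF xy(1)], of k] shift_map_fixed_point[OF fixed[OF xy(2)], of k] by simp
  \<comment> \<open>Having disjoint supports, \<open>x\<close> would be 0 everywhere, against its
    coordinate equal to 1.\<close>
  then have "x = y"
    using inj_onD[OF inj _ xy(1,2)] by blast
  moreover obtain m where "x m = 1"
    using flores_complexD(5)[OF xy(1)] by blast
  ultimately show False
    using xy(4)[of m] by simp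
qed

theorem proposition8p1:
  fixes D :: nat
  assumes "D \<ge> 1"
  shows "\<exists>K :: (nat \<Rightarrow> real) topology.
           topological_dynamical_system K id \<and>
           dynamical_dim K id = of_nat D \<and>
           \<not> (\<exists>F. equivariant_embedding K id (cubical_shift_topology (2 * D)) shift_map F)"
  using topological_dynamical_system_flores_complex dynamical_dim_flores_complex
    flores_complex_no_equivariant_embedding by blast

end
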